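(* Let $\pi_{\rm joint}=\exp(-V_{\rm joint})$ be a probability density on $\mathbb{R}^{n_x}\times\mathbb{R}^{n_y}$ such that $V_{\rm joint}\in C^2(\mathbb{R}^{n_x}\times\mathbb{R}^{n_y})$ is convex, $L(\pi_{\rm joint})<\infty$, and $\psi(\pi_{\rm joint})>0$. Let $\pi_{\rm marg}(\mathbf{y})=\int_{\mathbb{R}^{n_x}}\pi_{\rm joint}(\mathbf{x},\mathbf{y})\,\mathrm{d}\mathbf{x}$. Then $$\hat\kappa(\pi_{\rm marg})\le\hat\kappa(\pi_{\rm joint}).$$ In the special case where $\pi_{\rm joint}$ is strongly log-concave, i.e., $m(\pi_{\rm joint})>0$, we have $$\kappa(\pi_{\rm marg})\le\kappa(\pi_{\rm joint}).$$
   Context: For a probability density $\pi=\exp(-V)$ on $\mathbb{R}^d$ with $V\in C^2(\mathbb{R}^d)$ convex, define $L(\pi)=\inf\{L\ge0:\nabla^2V(\mathbf{z})\preceq L\,\mathbf{I}_d\ \forall\mathbf{z}\in\mathbb{R}^d\}$ and $m(\pi)=\sup\{m\ge0:m\,\mathbf{I}_d\preceq\nabla^2V(\mathbf{z})\ \forall\mathbf{z}\in\mathbb{R}^d\}$; if $m(\pi)>0$, $\kappa(\pi)=L(\pi)/m(\pi)$. For nonempty $S_1,S_2\subseteq\mathbb{R}^d$ let $D(S_1,S_2)=\inf_{\mathbf{z}_1\in S_1,\mathbf{z}_2\in S_2}\|\mathbf{z}_1-\mathbf{z}_2\|_2$. A probability distribution $\pi$ on $\mathbb{R}^d$ satisfies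 an isoperimetric inequality with constant $\psi>0$ if $\pi(S_3)\ge\psi\,D(S_1,S_2)\,\pi(S_1)\,\pi(S_2)$ for every measurable partition $(S_1,S_2,S_3)$ of $\mathbb{R}^d$ with $S_1$ and $S_2$ nonempty. $\psi(\pi)$ is the supremum of all constants for which this holds ($0$ if there is none). If $\psi(\pi)>0$, $\hat\kappa(\pi)=L(\pi)/\psi(\pi)^2$. *)

theory Defs
  imports "HOL-Probability.Probability"
begin

text \<open>
  Densities are functions \<open>\<pi>\<close> on a Euclidean space, taken with respect to
  \<^const>\<open>lborel\<close>. The quantities \<open>L\<close>, \<open>m\<close>, \<open>\<psi>\<close> and the condition numbers take values in
  \<^typ>\<open>ennreal\<close>, so that infima and suprema of sets of nonnegative reals
  have their usual extended values: \<open>Inf {} = \<infinity>\<close> and \<open>Sup {} = 0\<close>.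
\<close>

definition gradient :: "('a::real_inner \<Rightarrow> real) \<Rightarrow> 'a \<Rightarrow> 'a" where
  "gradient V z = (THE g. GDERIV V z :> g)"

text \<open>The Hessian at a point, as a linear operator rather than a matrix.\<close>

definition hessian :: "('a::real_inner \<Rightarrow> real) \<Rightarrow> 'a \<Rightarrow> 'a \<Rightarrow> 'a" where
  "hessian V z = frechet_derivative (gradient V) (at z)"

text \<open>
  In finite dimension, continuity of \<open>z \<mapsto> hessian V z h\<close> for every \<open>h\<close> is continuity of the
  Hessian as an operator-valued map.
\<close>

definition C2 :: "('a::euclidean_space \<Rightarrow> real) \<Rightarrow> bool" where
  "C2 V \<longleftrightarrow>
     (\<forall>z. V differentiable (at z)) \<and>
     (\<forall>z. gradient V differentiable (at z)) \<and>
     (\<forall>h. continuous_on UNIV (\<lambda>z. hessian V z h))"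

text \<open>Loewner order, for symmetric operators.\<close>

definition loewner_le :: "('a::real_inner \<Rightarrow> 'a) \<Rightarrow> ('a \<Rightarrow> 'a) \<Rightarrow> bool" (infix "\<preceq>\<^sub>L" 50) where
  "A \<preceq>\<^sub>L B \<longleftrightarrow> (\<forall>v. A v \<bullet> v \<le> B v \<bullet> v)"

definition distr_of :: "('a::euclidean_space \<Rightarrow> real) \<Rightarrow> 'a measure" where
  "distr_of \<pi> = density lborel (\<lambda>z. ennreal (\<pi> z))"

definition C2_log_concave_density :: "('a::euclidean_space \<Rightarrow> real) \<Rightarrow> bool" where
  "C2_log_concave_density \<pi> \<longleftrightarrow>
     (\<exists>V. \<pi> = (\<lambda>z. exp (- V z)) \<and> C2 V \<and> convex_on UNIV V) \<and> prob_space (distr_of \<pi>)"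

text \<open>The function \<open>V\<close> with \<open>\<pi> = exp (- V)\<close>, recovered from a positive density \<open>\<pi>\<close>.\<close>

definition potential :: "('a \<Rightarrow> real) \<Rightarrow> 'a \<Rightarrow> real" where
  "potential \<pi> z = - ln (\<pi> z)"

definition L_const :: "('a::euclidean_space \<Rightarrow> real) \<Rightarrow> ennreal" where
  "L_const \<pi> =
     Inf {ennreal L | L. 0 \<le> L \<and> (\<forall>z. hessian (potential \<pi>) z \<preceq>\<^sub>L (\<lambda>v. L *\<^sub>R v))}"

definition m_const :: "('a::euclidean_space \<Rightarrow> real) \<Rightarrow> ennreal" where
  "m_const \<pi> =
     Sup {ennreal m | m. 0 \<le> m \<and> (\<forall>z. (\<lambda>v. m *\<^sub>R v) \<preceq>\<^sub>L hessian (potential \<pi>) z)}"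

text \<open>Meaningful only when \<open>m_const \<pi> > 0\<close>.\<close>

definition kappa :: "('a::euclidean_space \<Rightarrow> real) \<Rightarrow> ennreal" where
  "kappa \<pi> = L_const \<pi> / m_const \<pi>"

text \<open>\<open>S\<^sub>3\<close> may be empty; for nonempty \<open>S\<^sub>1\<close>, \<open>S\<^sub>2\<close>, \<^const>\<open>setdist\<close> is the infimal distance.\<close>

definition isoperimetric :: "'a::euclidean_space measure \<Rightarrow> real \<Rightarrow> bool" where
  "isoperimetric \<mu> c \<longleftrightarrow> 0 < c \<and>
     (\<forall>S\<^sub>1\<in>sets borel. \<forall>S\<^sub>2\<in>sets borel. \<forall>S\<^sub>3\<in>sets borel.
        S\<^sub>1 \<union> S\<^sub>2 \<union> S\<^sub>3 = UNIV \<and> S\<^sub>1 \<inter> S\<^sub>2 = {} \<and> S\<^sub>1 \<inter> S\<^sub>3 = {} \<and> S\<^sub>2 \<inter> S\<^sub>3 = {} \<and>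
        S\<^sub>1 \<noteq> {} \<and> S\<^sub>2 \<noteq> {} \<longrightarrow>
        measure \<mu> S\<^sub>3 \<ge> c * setdist S\<^sub>1 S\<^sub>2 * measure \<mu> S\<^sub>1 * measure \<mu> S\<^sub>2)"

definition psi :: "'a::euclidean_space measure \<Rightarrow> ennreal" where
  "psi \<mu> = Sup {ennreal c | c. isoperimetric \<mu> c}"

text \<open>Meaningful only when \<open>psi (distr_of \<pi>) > 0\<close>.\<close>

definition kappa_hat :: "('a::euclidean_space \<Rightarrow> real) \<Rightarrow> ennreal" where
  "kappa_hat \<pi> = L_const \<pi> / (psi (distr_of \<pi>))\<^sup>2"

end

theory Submission
  imports Defs
begin

text \<open>
  Write \<open>V\<close> for the joint potential, \<open>P\<close> for the marginal density and \<open>V\<^sub>m = - ln P\<close>. The claim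
  splits into three monotonicity statements: marginalisation does not increase \<open>L\<close>, does not
  decrease \<open>m\<close>, and does not decrease \<open>\<psi>\<close>. Both condition numbers are quotients that are monotone
  in these quantities.

  For \<open>\<psi>\<close> the reason is geometric: the marginal law is the image of the joint law under the
  projection, which is \<open>1\<close>-Lipschitz, so a partition of the target pulls back to a partition with
  the same masses whose first two parts are at least as far apart (\<open>psi_contraction\<close>).

  For \<open>L\<close> and \<open>m\<close> a Hessian bound is traded for a bound on second differences: for a twice
  differentiable \<open>V\<close>, the bound \<open>m |v|\<^sup>2 \<le> \<langle>\<nabla>\<^sup>2V v, v\<rangle>\<close> everywhere is equivalent to
  \<open>2 V z + m |h|\<^sup>2 \<le> V (z + h) + V (z - h)\<close> everywhere
  (\<open>hessian_lower_bound_iff_second_difference\<close>), and the sign of \<open>m\<close> is arbitrary, so upper bounds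
  are covered as well. In this form the two bounds are inequalities between the three integrals
  \<open>P (y + h)\<close>, \<open>P (y - h)\<close> and \<open>P y\<close>. The upper bound says that each slice \<open>e\<^bsup>-V(x, \<cdot>)\<^esup>\<close> is
  log-convex up to the factor \<open>e\<^bsup>L|h|\<^sup>2/2\<^esup>\<close>, and sums of log-convex functions are log-convex, by
  the Cauchy--Schwarz inequality (\<open>marg_second_difference_upper\<close>). The lower bound is the theorem
  of Prekopa, here as a direct consequence of the inequality
  \<open>(\<integral>f) (\<integral>g) \<le> (\<integral>h)\<^sup>2\<close> whenever \<open>f x g y \<le> h ((x + y) / 2)\<^sup>2\<close> (\<open>prekopa_leindler\<close>,
  \<open>marg_second_difference_lower\<close>).

  It remains to see that \<open>V\<^sub>m\<close> is twice continuously differentiable. A convex \<open>V\<close> with integrable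
  \<open>e\<^bsup>-V\<^esup>\<close> grows at least linearly (\<open>convex_integrable_growth\<close>). Convexity and the Hessian bound
  \<open>L\<close> give \<open>|\<nabla>V|\<^sup>2 \<le> 2 L (V - inf V)\<close> and \<open>|\<nabla>\<^sup>2V v| \<le> L |v|\<close>, so all
  derivatives of \<open>e\<^bsup>-V\<^esup>\<close> up to order two are bounded by a multiple of \<open>e\<^bsup>-a|x|/2\<^esup>\<close>, uniformly in
  \<open>y\<close>, and dominated convergence permits differentiating twice under the integral.
\<close>

section \<open>The one-dimensional Brunn--Minkowski and layer-cake formulas\<close>

text \<open>
  Choose \<open>a \<in> A\<close> almost at the top of \<open>A\<close> and \<open>b \<in> B\<close> almost at the bottom of \<open>B\<close>. The
  half-scaled sets \<open>(A + b) / 2\<close> and \<open>(a + B) / 2\<close> both lie in \<open>C\<close>, and they overlap only in a tiny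
  interval around \<open>(a + b) / 2\<close>. Working up to \<open>e\<close> avoids passing to compact sets, where the
  extreme points would be attained.
\<close>

lemma brunn_minkowski_real_bounded:
  fixes A B C :: "real set"
  assumes [measurable]: "A \<in> sets borel" "B \<in> sets borel" "C \<in> sets borel"
    and ne: "A \<noteq> {}" "B \<noteq> {}" and bd: "bounded A" "bounded B"
    and mid: "\<And>a b. a \<in> A \<Longrightarrow> b \<in> B \<Longrightarrow> (a + b) / 2 \<in> C"
  shows "emeasure lborel A + emeasure lborel B \<le> 2 * emeasure lborel C"
proof (rule ennreal_le_epsilon)
  fix e :: real assume e: "0 < e"
  have bdA: "bdd_above A" and bdB: "bdd_below B"
    using bd by (auto simp: bounded_imp_bdd_above bounded_imp_bdd_below)
  obtain a where a: "a \<in> A" "Sup A - e / 2 < a"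
    using less_cSupD[OF ne(1), of "Sup A - e / 2"] e by auto
  obtain b where b: "b \<in> B" "b < Inf B + e / 2"
    using cInf_lessD[OF ne(2), of "Inf B + e / 2"] e by auto
  \<comment> \<open>The factor \<open>2\<close> in these preimages encodes the halving: \<open>A' = (A + b) / 2\<close> and \<open>B' = (a + B) / 2\<close>.\<close>
  define A' where "A' = (\<lambda>x. - b + 2 * x) -` A"
  define B' where "B' = (\<lambda>x. - a + 2 * x) -` B"
  have [measurable]: "A' \<in> sets borel" "B' \<in> sets borel"
    unfolding A'_def B'_def
    by (auto intro!: measurable_sets_borel[OF _ assms(1)] measurable_sets_borel[OF _ assms(2)])
  have half: "emeasure lborel S = 2 * emeasure lborel ((\<lambda>x. t + 2 * x) -` S)"
    if [measurable]: "S \<in> sets borel" for S :: "real set" and t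
  proof -
    have m: "(\<lambda>x. t + 2 * x) -` S \<in> sets borel"
      by (auto intro!: measurable_sets_borel[OF _ that])
    have "emeasure lborel S = (\<integral>\<^sup>+x. indicator S x \<partial>lborel)" by simp
    also have "\<dots> = 2 * (\<integral>\<^sup>+x. indicator S (t + 2 * x) \<partial>lborel)"
      by (subst nn_integral_real_affine[where c=2 and t=t]) auto
    also have "(\<lambda>x. indicator S (t + 2 * x) :: ennreal) = indicator ((\<lambda>x. t + 2 * x) -` S)"
      by (auto simp: indicator_def)
    finally show ?thesis using m by simp
  qed
  have sub: "A' \<union> B' \<subseteq> C"
  proof
    fix z assume "z \<in> A' \<union> B'"
    then show "z \<in> C"
      using mid[OF _ b(1), of "-b + 2*z"] mid[OF a(1), of "-a + 2*z"] by (auto simp: A'_def B'_def)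
  qed
  have ov: "A' \<inter> B' \<subseteq> {(a + Inf B) / 2 .. (Sup A + b) / 2}"
  proof
    fix z assume z: "z \<in> A' \<inter> B'"
    then have "-b + 2*z \<le> Sup A" "Inf B \<le> -a + 2*z"
      using cSup_upper[OF _ bdA] cInf_lower[OF _ bdB] by (auto simp: A'_def B'_def)
    then show "z \<in> {(a + Inf B) / 2 .. (Sup A + b) / 2}" by auto
  qed
  have "emeasure lborel (A' \<inter> B') \<le> emeasure lborel {(a + Inf B) / 2 .. (Sup A + b) / 2}"
    using ov by (intro emeasure_mono) auto
  also have "\<dots> \<le> ennreal (e / 2)"
    using a b e by (auto intro!: ennreal_leI simp: field_simps emeasure_lborel_Icc_eq)
  finally have small: "emeasure lborel (A' \<inter> B') \<le> ennreal (e / 2)" .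
  have "emeasure lborel A' + emeasure lborel B' =
      emeasure lborel (A' \<union> B') + emeasure lborel (A' \<inter> B')"
    by (rule emeasure_Un_Int) auto
  also have "\<dots> \<le> emeasure lborel C + ennreal (e / 2)"
    using sub small by (intro add_mono emeasure_mono) auto
  finally have "2 * (emeasure lborel A' + emeasure lborel B') \<le> 2 * (emeasure lborel C + ennreal (e / 2))"
    by (rule mult_left_mono) auto
  also have "\<dots> = 2 * emeasure lborel C + ennreal e"
  proof -
    have "(2::ennreal) * ennreal (e / 2) = ennreal (2 * (e / 2))"
      by (subst ennreal_mult) (use e in auto)
    then show ?thesis by (simp add: distrib_left)
  qed
  finally show "emeasure lborel A + emeasure lborel B \<le> 2 * emeasure lborel C + ennreal e"
    using half[of A "-b"] half[of B "-a"] by (simp add: A'_def B'_def distrib_left)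
qed

lemma brunn_minkowski_real:
  fixes A B C :: "real set"
  assumes [measurable]: "A \<in> sets borel" "B \<in> sets borel" "C \<in> sets borel"
    and ne: "A \<noteq> {}" "B \<noteq> {}"
    and mid: "\<And>a b. a \<in> A \<Longrightarrow> b \<in> B \<Longrightarrow> (a + b) / 2 \<in> C"
  shows "emeasure lborel A + emeasure lborel B \<le> 2 * emeasure lborel C"
proof -
  obtain a b where ab: "a \<in> A" "b \<in> B" using ne by auto
  define I where "I n = {- (\<bar>a\<bar> + \<bar>b\<bar> + real n) .. \<bar>a\<bar> + \<bar>b\<bar> + real n}" for n
  have lim: "(\<lambda>n. emeasure lborel (S \<inter> I n)) \<longlonglongrightarrow> emeasure lborel S"
    if [measurable]: "S \<in> sets borel" for S
  proof -
    have "(\<Union>n. S \<inter> I n) = S"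
    proof -
      have "\<exists>n. x \<in> I n" for x
      proof -
        obtain n where "\<bar>x\<bar> \<le> real n" using real_arch_simple by blast
        then show ?thesis by (intro exI[of _ n]) (auto simp: I_def)
      qed
      then show ?thesis by blast
    qed
    moreover have "(\<lambda>n. emeasure lborel (S \<inter> I n)) \<longlonglongrightarrow> emeasure lborel (\<Union>n. S \<inter> I n)"
      by (intro Lim_emeasure_incseq) (auto simp: I_def incseq_def)
    ultimately show ?thesis by simp
  qed
  have "emeasure lborel (A \<inter> I n) + emeasure lborel (B \<inter> I n) \<le> 2 * emeasure lborel C" for n
  proof (rule brunn_minkowski_real_bounded)
    have "a \<in> A \<inter> I n" "b \<in> B \<inter> I n" using ab by (auto simp: I_def)
    then show "A \<inter> I n \<noteq> {}" "B \<inter> I n \<noteq> {}" by auto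
    have "bounded (I n)" unfolding I_def by (rule bounded_closed_interval)
    then show "bounded (A \<inter> I n)" "bounded (B \<inter> I n)" by (auto intro: bounded_subset)
    show "A \<inter> I n \<in> sets borel" "B \<inter> I n \<in> sets borel" by (auto simp: I_def)
  qed (use mid in auto)
  then show ?thesis
    by (intro LIMSEQ_le_const2[OF tendsto_add[OF lim lim]]) auto
qed

text \<open>
  Tonelli's theorem for the region below the graph of \<open>f\<close>.
\<close>

lemma layer_cake:
  fixes f :: "real \<Rightarrow> ennreal"
  assumes [measurable]: "f \<in> borel_measurable borel"
  shows "(\<integral>\<^sup>+x. f x \<partial>lborel) = (\<integral>\<^sup>+s. emeasure lborel {x. ennreal s < f x} * indicator {0..} s \<partial>lborel)"
proof -
  have slice: "(\<integral>\<^sup>+s. (if 0 \<le> s \<and> ennreal s < u then 1 else 0) \<partial>lborel) = u" for u :: ennreal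
  proof -
    have ind: "(\<lambda>s. if 0 \<le> s \<and> ennreal s < u then 1 else 0) =
        (indicator {s. 0 \<le> s \<and> ennreal s < u} :: real \<Rightarrow> ennreal)"
      by (auto simp: indicator_def)
    show ?thesis
  proof (cases u)
    case (real r)
    then have "{s. 0 \<le> s \<and> ennreal s < u} = {0..<r}"
      by (auto simp: ennreal_less_iff)
    then show ?thesis using real unfolding ind by simp
  next
    case top
    then have "{s. 0 \<le> s \<and> ennreal s < u} = {0..}" by auto
    moreover have "emeasure lborel {0::real..} = \<infinity>"
    proof (rule ccontr)
      assume "emeasure lborel {0::real..} \<noteq> \<infinity>"
      then obtain n where n: "emeasure lborel {0::real..} < of_nat n"
        using ennreal_Ex_less_of_nat[of "emeasure lborel {0::real..}"]
        by (auto simp: top.not_eq_extremum)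
      have "of_nat n = emeasure lborel {0..real n}" by (simp add: ennreal_of_nat_eq_real_of_nat)
      also have "\<dots> \<le> emeasure lborel {0::real..}" by (intro emeasure_mono) auto
      finally show False using n by simp
    qed
    ultimately show ?thesis using top unfolding ind by simp
  qed
  qed
  have "(\<integral>\<^sup>+x. f x \<partial>lborel) =
      (\<integral>\<^sup>+x. (\<integral>\<^sup>+s. (if 0 \<le> s \<and> ennreal s < f x then 1 else 0) \<partial>lborel) \<partial>lborel)"
    by (simp only: slice)
  also have "\<dots> = (\<integral>\<^sup>+s. (\<integral>\<^sup>+x. (if 0 \<le> s \<and> ennreal s < f x then 1 else 0) \<partial>lborel) \<partial>lborel)"
    by (rule lborel_pair.Fubini') measurable
  also have "\<dots> = (\<integral>\<^sup>+s. emeasure lborel {x. ennreal s < f x} * indicator {0..} s \<partial>lborel)"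
  proof (rule nn_integral_cong)
    fix s :: real
    have "(\<integral>\<^sup>+x. (if 0 \<le> s \<and> ennreal s < f x then 1 else 0) \<partial>lborel) =
       (\<integral>\<^sup>+x. indicator {x. ennreal s < f x} x * indicator {0..} s \<partial>lborel)"
      by (intro nn_integral_cong) (auto simp: indicator_def)
    also have "\<dots> = emeasure lborel {x. ennreal s < f x} * indicator {0..} s"
      by (subst nn_integral_multc) auto
    finally show "(\<integral>\<^sup>+x. (if 0 \<le> s \<and> ennreal s < f x then 1 else 0) \<partial>lborel) =
       emeasure lborel {x. ennreal s < f x} * indicator {0..} s" .
  qed
  finally show ?thesis .
qed

text \<open>
  When both suprema are \<open>1\<close>, the level sets of \<open>f\<close> and \<open>g\<close> at any height \<open>s < 1\<close> are nonempty, so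
  Brunn--Minkowski compares them with the level set of \<open>h\<close> at the same height; integrating over
  \<open>s\<close> gives even the arithmetic-mean version of the inequality.
\<close>

lemma prekopa_leindler_real_normalized:
  fixes f g h :: "real \<Rightarrow> ennreal"
  assumes [measurable]: "f \<in> borel_measurable borel" "g \<in> borel_measurable borel"
      "h \<in> borel_measurable borel"
    and sup: "(SUP x. f x) = 1" "(SUP x. g x) = 1"
    and mid: "\<And>x y. f x * g y \<le> (h ((x + y) / 2))\<^sup>2"
  shows "(\<integral>\<^sup>+x. f x \<partial>lborel) + (\<integral>\<^sup>+x. g x \<partial>lborel) \<le> 2 * (\<integral>\<^sup>+x. h x \<partial>lborel)"
proof -
  have lev: "emeasure lborel {x. ennreal s < f x} + emeasure lborel {x. ennreal s < g x}
      \<le> 2 * emeasure lborel {x. ennreal s < h x}" if s: "0 \<le> s" for s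
  proof (cases "s < 1")
    case True
    then have s1: "ennreal s < 1" by (simp add: ennreal_less_one_iff)
    show ?thesis
    proof (rule brunn_minkowski_real)
      show "{x. ennreal s < f x} \<noteq> {}" "{x. ennreal s < g x} \<noteq> {}"
        using s1 sup less_SUP_iff[of "ennreal s" f UNIV] less_SUP_iff[of "ennreal s" g UNIV] by auto
      fix a b assume "a \<in> {x. ennreal s < f x}" "b \<in> {x. ennreal s < g x}"
      then have fg: "ennreal s < f a" "ennreal s < g b" by auto
      have "(ennreal s)\<^sup>2 < f a * g b"
      proof (cases "s = 0")
        case True
        then show ?thesis using fg by (simp add: ennreal_zero_less_mult_iff)
      next
        case False
        then have "(ennreal s)\<^sup>2 < ennreal s * g b"
          unfolding power2_eq_square using fg s by (intro ennreal_mult_strict_left_mono) auto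
        also have "\<dots> \<le> f a * g b" using fg by (intro mult_right_mono) auto
        finally show ?thesis .
      qed
      also have "\<dots> \<le> (h ((a + b) / 2))\<^sup>2" by (rule mid)
      finally show "(a + b) / 2 \<in> {x. ennreal s < h x}"
        by (metis mem_Collect_eq not_less power_mono zero_le)
    qed measurable
  next
    case False
    have "f x \<le> 1" "g x \<le> 1" for x
      using SUP_upper[of x UNIV f] SUP_upper[of x UNIV g] sup by auto
    moreover have "1 \<le> ennreal s" using False ennreal_leI[of 1 s] by simp
    ultimately have "f x \<le> ennreal s" "g x \<le> ennreal s" for x by (metis order_trans)+
    then have "{x. ennreal s < f x} = {}" "{x. ennreal s < g x} = {}"
      by (simp_all add: not_less)
    then show ?thesis by simp
  qed
  have "(\<integral>\<^sup>+x. f x \<partial>lborel) + (\<integral>\<^sup>+x. g x \<partial>lborel) =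
     (\<integral>\<^sup>+s. (emeasure lborel {x. ennreal s < f x} + emeasure lborel {x. ennreal s < g x})
        * indicator {0..} s \<partial>lborel)"
    by (subst (1 2) layer_cake) (auto simp: nn_integral_add distrib_right)
  also have "\<dots> \<le> (\<integral>\<^sup>+s. 2 * (emeasure lborel {x. ennreal s < h x} * indicator {0..} s) \<partial>lborel)"
    by (intro nn_integral_mono) (use lev in \<open>auto simp: indicator_def\<close>)
  also have "\<dots> = 2 * (\<integral>\<^sup>+x. h x \<partial>lborel)"
    by (subst (2) layer_cake) (auto simp: nn_integral_cmult)
  finally show ?thesis .
qed

section \<open>The midpoint form of the Prekopa--Leindler inequality\<close>

lemma ennreal_four_mult_le_square_sum:
  fixes a b :: ennreal
  shows "4 * (a * b) \<le> (a + b)\<^sup>2"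
proof (cases "a = top \<or> b = top")
  case True
  then show ?thesis
    by (cases "a = 0 \<or> b = 0") (auto simp: power2_eq_square ennreal_mult_top ennreal_top_mult)
next
  case False
  then obtain x y where xy: "a = ennreal x" "b = ennreal y" "0 \<le> x" "0 \<le> y"
    by (metis ennreal_cases)
  have "4 * (x * y) \<le> (x + y)\<^sup>2"
    using zero_le_power2[of "x - y"] by (simp add: power2_eq_square algebra_simps)
  then have "ennreal (4 * (x * y)) \<le> ennreal ((x + y)\<^sup>2)" by (rule ennreal_leI)
  then show ?thesis
    using xy by (simp add: ennreal_mult ennreal_power[symmetric])
qed

text \<open>
  The hypothesis and the conclusion are homogeneous, so \<open>f\<close> and \<open>g\<close> can be rescaled to have
  supremum \<open>1\<close>, with \<open>h\<close> rescaled by the geometric mean of the two factors. The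
  arithmetic-geometric mean inequality then weakens the sum to a product.
\<close>

lemma prekopa_leindler_real_bounded:
  fixes f g h :: "real \<Rightarrow> ennreal" and B :: real
  assumes [measurable]: "f \<in> borel_measurable borel" "g \<in> borel_measurable borel"
      "h \<in> borel_measurable borel"
    and bd: "\<And>x. f x \<le> ennreal B" "\<And>x. g x \<le> ennreal B"
    and mid: "\<And>x y. f x * g y \<le> (h ((x + y) / 2))\<^sup>2"
  shows "(\<integral>\<^sup>+x. f x \<partial>lborel) * (\<integral>\<^sup>+x. g x \<partial>lborel) \<le> (\<integral>\<^sup>+x. h x \<partial>lborel)\<^sup>2"
proof (cases "(SUP x. f x) = 0 \<or> (SUP x. g x) = 0")
  case True
  have "f x = 0" if "(SUP x. f x) = 0" for x using SUP_upper[of x UNIV f] that by simp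
  moreover have "g x = 0" if "(SUP x. g x) = 0" for x using SUP_upper[of x UNIV g] that by simp
  ultimately show ?thesis using True by auto
next
  case False
  have "(SUP x. f x) \<le> ennreal B" "(SUP x. g x) \<le> ennreal B" using bd by (auto intro: SUP_least)
  then have "(SUP x. f x) \<noteq> top" "(SUP x. g x) \<noteq> top" by (metis ennreal_neq_top top_unique)+
  with False obtain F G where FG: "(SUP x. f x) = ennreal F" "(SUP x. g x) = ennreal G" "0 < F" "0 < G"
    by (metis ennreal_cases ennreal_eq_0_iff not_le)
  define c where "c = 1 / F"
  define d where "d = 1 / G"
  define e where "e = sqrt (c * d)"
  have pos: "0 < c" "0 < d" "0 < e" using FG by (auto simp: c_def d_def e_def)
  have e2: "(ennreal e)\<^sup>2 = ennreal c * ennreal d"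
    using pos by (simp add: ennreal_power e_def ennreal_mult)
  let ?If = "\<integral>\<^sup>+x. f x \<partial>lborel" and ?Ig = "\<integral>\<^sup>+x. g x \<partial>lborel" and ?Ih = "\<integral>\<^sup>+x. h x \<partial>lborel"
  have "(\<integral>\<^sup>+x. c * f x \<partial>lborel) + (\<integral>\<^sup>+x. d * g x \<partial>lborel) \<le> 2 * (\<integral>\<^sup>+x. e * h x \<partial>lborel)"
  proof (rule prekopa_leindler_real_normalized)
    show "(SUP x. ennreal c * f x) = 1" "(SUP x. ennreal d * g x) = 1"
      using FG by (auto simp: SUP_mult_left_ennreal[symmetric] c_def d_def ennreal_mult[symmetric])
    fix x y
    have "(ennreal c * f x) * (ennreal d * g y) = (ennreal e)\<^sup>2 * (f x * g y)"
      by (simp add: e2 ac_simps)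
    also have "\<dots> \<le> (ennreal e)\<^sup>2 * (h ((x + y) / 2))\<^sup>2" by (intro mult_left_mono mid) auto
    finally show "ennreal c * f x * (ennreal d * g y) \<le> (ennreal e * h ((x + y) / 2))\<^sup>2"
      by (simp add: power_mult_distrib)
  qed measurable
  then have sum: "c * ?If + d * ?Ig \<le> 2 * (e * ?Ih)" by (simp add: nn_integral_cmult)
  have "4 * (ennreal e)\<^sup>2 * (?If * ?Ig) = 4 * ((c * ?If) * (d * ?Ig))" by (simp add: e2 ac_simps)
  also have "\<dots> \<le> (c * ?If + d * ?Ig)\<^sup>2" by (rule ennreal_four_mult_le_square_sum)
  also have "\<dots> \<le> (2 * (e * ?Ih))\<^sup>2" by (intro power_mono sum) auto
  also have "\<dots> = 4 * (ennreal e)\<^sup>2 * ?Ih\<^sup>2" by (simp add: power_mult_distrib ac_simps)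
  finally have "4 * (ennreal e)\<^sup>2 * (?If * ?Ig) \<le> 4 * (ennreal e)\<^sup>2 * ?Ih\<^sup>2" .
  moreover have "4 * (ennreal e)\<^sup>2 = ennreal (4 * e\<^sup>2)" using pos by (simp add: ennreal_mult ennreal_power)
  ultimately show ?thesis
    using pos by (metis ennreal_mult_le_mult_iff ennreal_neq_top ennreal_eq_0_iff not_le
        mult_pos_pos zero_less_power zero_less_numeral)
qed

lemma prekopa_leindler_real:
  fixes f g h :: "real \<Rightarrow> ennreal"
  assumes [measurable]: "f \<in> borel_measurable borel" "g \<in> borel_measurable borel"
      "h \<in> borel_measurable borel"
    and mid: "\<And>x y. f x * g y \<le> (h ((x + y) / 2))\<^sup>2"
  shows "(\<integral>\<^sup>+x. f x \<partial>lborel) * (\<integral>\<^sup>+x. g x \<partial>lborel) \<le> (\<integral>\<^sup>+x. h x \<partial>lborel)\<^sup>2"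
proof -
  define tr where "tr u n x = min (u x) (of_nat n)" for u :: "real \<Rightarrow> ennreal" and n :: nat and x
  have [measurable]: "tr u n \<in> borel_measurable borel" if [measurable]: "u \<in> borel_measurable borel" for u n
    unfolding tr_def by measurable
  have trle: "tr u n x \<le> u x" for u n x by (simp add: tr_def)
  have lim: "(\<integral>\<^sup>+x. u x \<partial>lborel) = (SUP n. \<integral>\<^sup>+x. tr u n x \<partial>lborel)"
    if [measurable]: "u \<in> borel_measurable borel" for u :: "real \<Rightarrow> ennreal"
  proof -
    have sup: "(SUP n. tr u n x) = u x" for x
    proof -
      have "(SUP n. of_nat n :: ennreal) = top" by (rule ennreal_SUP_of_nat_eq_top)
      then have "(SUP n. tr u n x) = inf (u x) top"
        unfolding tr_def by (metis (no_types, lifting) SUP_cong inf_SUP inf_min)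
      then show ?thesis by simp
    qed
    have "incseq (tr u)"
      by (auto simp: tr_def incseq_def le_fun_def intro: min.coboundedI2)
    then have "(\<integral>\<^sup>+x. (SUP n. tr u n x) \<partial>lborel) = (SUP n. \<integral>\<^sup>+x. tr u n x \<partial>lborel)"
      by (intro nn_integral_monotone_convergence_SUP) auto
    then show ?thesis by (simp add: sup)
  qed
  have "(\<integral>\<^sup>+x. tr f n x \<partial>lborel) * (\<integral>\<^sup>+x. tr g k x \<partial>lborel) \<le> (\<integral>\<^sup>+x. h x \<partial>lborel)\<^sup>2" for n k
  proof (rule prekopa_leindler_real_bounded[where B = "real (max n k)"])
    show "tr f n x \<le> ennreal (real (max n k))" "tr g k x \<le> ennreal (real (max n k))" for x
      unfolding tr_def ennreal_of_nat_eq_real_of_nat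
      by (auto intro!: min.coboundedI2 ennreal_leI)
    show "tr f n x * tr g k y \<le> (h ((x + y) / 2))\<^sup>2" for x y
      using mult_mono[OF trle[of f n x] trle[of g k y]] mid[of x y] by (auto intro: order_trans)
  qed measurable
  then show ?thesis
    by (auto simp: lim[of f] lim[of g] SUP_mult_left_ennreal SUP_mult_right_ennreal intro!: SUP_least)
qed

text \<open>
  The inequality tensorises: by the one-dimensional case, the integrals over the last coordinate
  satisfy the hypothesis in the remaining coordinates.
\<close>

lemma prekopa_leindler_PiM:
  fixes f g h :: "('i \<Rightarrow> real) \<Rightarrow> ennreal"
  assumes "finite I"
    and "f \<in> borel_measurable (PiM I (\<lambda>_. lborel))" "g \<in> borel_measurable (PiM I (\<lambda>_. lborel))"
      "h \<in> borel_measurable (PiM I (\<lambda>_. lborel))"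
    and "\<And>x y. x \<in> extensional I \<Longrightarrow> y \<in> extensional I \<Longrightarrow>
      f x * g y \<le> (h (\<lambda>i\<in>I. (x i + y i) / 2))\<^sup>2"
  shows "(\<integral>\<^sup>+x. f x \<partial>PiM I (\<lambda>_. lborel)) * (\<integral>\<^sup>+x. g x \<partial>PiM I (\<lambda>_. lborel))
    \<le> (\<integral>\<^sup>+x. h x \<partial>PiM I (\<lambda>_. lborel))\<^sup>2"
  using assms
proof (induction I arbitrary: f g h rule: finite_induct)
  case empty
  interpret product_sigma_finite "\<lambda>_::'i. lborel :: real measure" by standard
  have "(\<lambda>i\<in>{}. (x i + y i) / 2) = (\<lambda>_. undefined)" for x y :: "'i \<Rightarrow> real" by (auto simp: restrict_def)
  then show ?case using empty(4)[of "\<lambda>_. undefined" "\<lambda>_. undefined"] by (simp add: nn_integral_empty)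
next
  case (insert i I)
  interpret product_sigma_finite "\<lambda>_::'i. lborel :: real measure" by standard
  note [measurable] = insert.prems(1-3)
  have ins: "(\<integral>\<^sup>+x. u x \<partial>PiM (insert i I) (\<lambda>_. lborel)) =
      (\<integral>\<^sup>+x. (\<integral>\<^sup>+t. u (x(i := t)) \<partial>lborel) \<partial>PiM I (\<lambda>_. lborel))"
    if "u \<in> borel_measurable (PiM (insert i I) (\<lambda>_. lborel))" for u :: "('i \<Rightarrow> real) \<Rightarrow> ennreal"
    by (rule product_nn_integral_insert[OF insert.hyps(1,2) that])
  show ?case
    unfolding ins[OF insert.prems(1)] ins[OF insert.prems(2)] ins[OF insert.prems(3)]
  proof (rule insert.IH)
    fix x y :: "'i \<Rightarrow> real" assume xy: "x \<in> extensional I" "y \<in> extensional I"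
    have sl: "(\<lambda>t. u (x(i := t))) \<in> borel_measurable borel"
      if "u \<in> borel_measurable (PiM (insert i I) (\<lambda>_. lborel))" "x \<in> extensional I" 
      for u :: "('i \<Rightarrow> real) \<Rightarrow> ennreal" and x
    proof -
      have "(\<lambda>t. x(i := t)) \<in> measurable lborel (PiM (insert i I) (\<lambda>_. lborel))"
        using that(2) by (intro measurable_fun_upd[where J=I]) (auto simp: space_PiM PiE_def extensional_def)
      then show ?thesis using that(1) by (auto intro: measurable_compose)
    qed
    have "(\<integral>\<^sup>+t. f (x(i := t)) \<partial>lborel) * (\<integral>\<^sup>+t. g (y(i := t)) \<partial>lborel)
       \<le> (\<integral>\<^sup>+t. h ((\<lambda>i\<in>I. (x i + y i) / 2)(i := t)) \<partial>lborel)\<^sup>2"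
    proof (rule prekopa_leindler_real)
      fix s t
      have "f (x(i := s)) * g (y(i := t))
          \<le> (h (\<lambda>k\<in>insert i I. ((x(i := s)) k + (y(i := t)) k) / 2))\<^sup>2"
        using xy by (intro insert.prems(4)) (auto simp: extensional_def)
      also have "(\<lambda>k\<in>insert i I. ((x(i := s)) k + (y(i := t)) k) / 2)
          = (\<lambda>i\<in>I. (x i + y i) / 2)(i := (s + t) / 2)"
        using insert.hyps by (auto simp: fun_eq_iff)
      finally show "f (x(i := s)) * g (y(i := t))
          \<le> (h ((\<lambda>i\<in>I. (x i + y i) / 2)(i := (s + t) / 2)))\<^sup>2" .
    qed (use sl xy insert.prems in \<open>auto simp: restrict_extensional\<close>)
    then show "(\<integral>\<^sup>+t. f (x(i := t)) \<partial>lborel) * (\<integral>\<^sup>+t. g (y(i := t)) \<partial>lborel)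
       \<le> (\<integral>\<^sup>+t. h ((\<lambda>i\<in>I. (x i + y i) / 2)(i := t)) \<partial>lborel)\<^sup>2" .
  qed measurable
qed

theorem prekopa_leindler:
  fixes f g h :: "'a::euclidean_space \<Rightarrow> ennreal"
  assumes [measurable]: "f \<in> borel_measurable borel" "g \<in> borel_measurable borel"
      "h \<in> borel_measurable borel"
    and mid: "\<And>x y. f x * g y \<le> (h ((1 / 2) *\<^sub>R (x + y)))\<^sup>2"
  shows "(\<integral>\<^sup>+x. f x \<partial>lborel) * (\<integral>\<^sup>+x. g x \<partial>lborel) \<le> (\<integral>\<^sup>+x. h x \<partial>lborel)\<^sup>2"
proof -
  let ?P = "PiM (Basis::'a set) (\<lambda>_. lborel)"
  let ?e = "\<lambda>x. \<Sum>b\<in>Basis. x b *\<^sub>R (b::'a)"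
  have eq: "(\<integral>\<^sup>+x. u x \<partial>lborel) = (\<integral>\<^sup>+x. u (?e x) \<partial>?P)"
    if [measurable]: "u \<in> borel_measurable borel" for u :: "'a \<Rightarrow> ennreal"
    by (subst lborel_eq) (simp add: nn_integral_distr)
  show ?thesis
    unfolding eq[OF assms(1)] eq[OF assms(2)] eq[OF assms(3)]
  proof (rule prekopa_leindler_PiM)
    fix x y :: "'a \<Rightarrow> real"
    have "?e (\<lambda>i\<in>Basis. (x i + y i) / 2) = (1 / 2) *\<^sub>R (?e x + ?e y)"
      by (simp add: scaleR_sum_right sum.distrib[symmetric] scaleR_add_left[symmetric] add_divide_distrib
          cong: sum.cong)
    then show "f (?e x) * g (?e y) \<le> (h (?e (\<lambda>i\<in>Basis. (x i + y i) / 2)))\<^sup>2"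
      using mid[of "?e x" "?e y"] by simp
  qed auto
qed

section \<open>Hessian bounds, convexity and second differences\<close>

text \<open>
  Gradient and second derivative are passed as explicit functions, so that a potential can be
  shifted by linear and quadratic functions without computing \<^const>\<open>gradient\<close> or
  \<^const>\<open>hessian\<close> anew.
\<close>

definition twice_diff :: "('a::euclidean_space \<Rightarrow> real) \<Rightarrow> ('a \<Rightarrow> 'a) \<Rightarrow> ('a \<Rightarrow> 'a \<Rightarrow> 'a) \<Rightarrow> bool" where
  "twice_diff V G H \<longleftrightarrow>
     (\<forall>z. (V has_derivative (\<lambda>h. G z \<bullet> h)) (at z)) \<and> (\<forall>z. (G has_derivative H z) (at z))"

lemma twice_diffD:
  assumes "twice_diff V G H"
  shows "(V has_derivative (\<lambda>h. G z \<bullet> h)) (at z)" "(G has_derivative H z) (at z)"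
  using assms by (auto simp: twice_diff_def)

lemma twice_diff_uminus:
  "twice_diff V G H \<Longrightarrow> twice_diff (\<lambda>z. - V z) (\<lambda>z. - G z) (\<lambda>z h. - H z h)"
  unfolding twice_diff_def by (auto intro!: derivative_eq_intros)

lemma twice_diff_sub_quadratic:
  assumes "twice_diff V G H"
  shows "twice_diff (\<lambda>z. V z - m / 2 * (norm z)\<^sup>2) (\<lambda>z. G z - m *\<^sub>R z) (\<lambda>z h. H z h - m *\<^sub>R h)"
  unfolding twice_diff_def power2_norm_eq_inner
  by (auto intro!: derivative_eq_intros twice_diffD[OF assms] simp: inner_commute algebra_simps)

lemma twice_diff_sub_linear:
  assumes "twice_diff V G H"
  shows "twice_diff (\<lambda>z. V z - g \<bullet> z) (\<lambda>z. G z - g) H"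
  unfolding twice_diff_def
  by (auto intro!: derivative_eq_intros twice_diffD[OF assms] simp: algebra_simps)

lemma twice_diff_line:
  assumes "twice_diff V G H"
  shows "((\<lambda>t. V (z + t *\<^sub>R v)) has_real_derivative G (z + t *\<^sub>R v) \<bullet> v) (at t)"
    and "((\<lambda>t. G (z + t *\<^sub>R v) \<bullet> v) has_real_derivative H (z + t *\<^sub>R v) v \<bullet> v) (at t)"
proof -
  have l: "((\<lambda>t. z + t *\<^sub>R v) has_derivative (\<lambda>s. s *\<^sub>R v)) (at t)"
    by (auto intro!: derivative_eq_intros)
  show "((\<lambda>t. V (z + t *\<^sub>R v)) has_real_derivative G (z + t *\<^sub>R v) \<bullet> v) (at t)"
    using has_derivative_compose[OF l twice_diffD(1)[OF assms]]
    by (simp add: has_field_derivative_def mult_commute_abs)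
  have lin: "linear (H (z + t *\<^sub>R v))"
    using twice_diffD(2)[OF assms] has_derivative_linear by blast
  show "((\<lambda>t. G (z + t *\<^sub>R v) \<bullet> v) has_real_derivative H (z + t *\<^sub>R v) v \<bullet> v) (at t)"
    using has_derivative_inner_left[OF has_derivative_compose[OF l twice_diffD(2)[OF assms]], of v]
    by (simp add: has_field_derivative_def linear_cmul[OF lin] mult.commute[of _ "_ \<bullet> _"])
qed

text \<open>
  The symmetric sum \<open>q t = V (z + t v) + V (z - t v)\<close> has \<open>q' 0 = 0\<close> and
  \<open>q'' 0 = 2 \<langle>H z v, v\<rangle>\<close>. If this were negative, \<open>q\<close> would drop below \<open>q 0 = 2 V z\<close>.
\<close>

lemma hessian_nonneg_of_midpoint_convex:
  assumes td: "twice_diff V G H"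
    and mid: "\<And>z h. 2 * V z \<le> V (z + h) + V (z - h)"
  shows "0 \<le> H z v \<bullet> v"
proof (rule ccontr)
  assume "\<not> 0 \<le> H z v \<bullet> v"
  then have neg: "2 * (H z v \<bullet> v) < 0" by simp
  define q where "q t = V (z + t *\<^sub>R v) + V (z + t *\<^sub>R (- v))" for t
  define q' where "q' t = G (z + t *\<^sub>R v) \<bullet> v + G (z + t *\<^sub>R (- v)) \<bullet> (- v)" for t
  have linH: "H z (- v) = - H z v"
    using has_derivative_linear[OF twice_diffD(2)[OF td]] by (rule linear_neg)
  have dq: "(q has_real_derivative q' t) (at t)" for t
    unfolding q_def q'_def by (intro DERIV_add twice_diff_line[OF td])
  have "(q' has_real_derivative H (z + 0 *\<^sub>R v) v \<bullet> v + H (z + 0 *\<^sub>R (- v)) (- v) \<bullet> (- v)) (at 0)"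
    unfolding q'_def by (intro DERIV_add twice_diff_line[OF td])
  then have "(q' has_real_derivative 2 * (H z v \<bullet> v)) (at 0)" by (simp add: linH)
  then obtain d where d: "0 < d" "\<And>h. 0 < h \<Longrightarrow> h < d \<Longrightarrow> q' (0 + h) < q' 0"
    using DERIV_neg_dec_right[OF _ neg] by blast
  have "q (d / 2) < q 0"
  proof (rule DERIV_neg_imp_decreasing_open[of 0 "d / 2" q])
    show "0 < d / 2" using d by simp
    fix x assume "0 < x" "x < d / 2"
    moreover have "q' 0 = 0" by (simp add: q'_def)
    ultimately have "q' x < 0" using d(2)[of x] by simp
    then show "\<exists>y. (q has_real_derivative y) (at x) \<and> y < 0" using dq by blast
  next
    show "continuous_on {0..d / 2} q"
      using dq by (meson DERIV_continuous_on has_field_derivative_at_within)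
  qed
  moreover have "q 0 \<le> q (d / 2)" using mid[of z "(d / 2) *\<^sub>R v"] by (simp add: q_def)
  ultimately show False by simp
qed

lemma convex_of_hessian_nonneg:
  assumes td: "twice_diff V G H" and psd: "\<And>z v. 0 \<le> H z v \<bullet> v"
  shows "convex_on UNIV V"
proof (rule convex_onI)
  fix t :: real and x y :: 'a assume t: "0 < t" "t < 1"
  have "convex_on UNIV (\<lambda>t. V (x + t *\<^sub>R (y - x)))"
    by (rule f''_ge0_imp_convex[OF convex_UNIV twice_diff_line[OF td] psd])
  from convex_onD[OF this, of t 0 1]
  show "V ((1 - t) *\<^sub>R x + t *\<^sub>R y) \<le> (1 - t) * V x + t * V y"
    using t by (simp add: algebra_simps)
qed auto

lemma midpoint_of_convex:
  assumes "convex_on UNIV V"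
  shows "2 * V z \<le> V (z + h) + V (z - h)"
proof -
  have "(1/2) *\<^sub>R (z + h) + (1/2) *\<^sub>R (z - h) = z"
    by (simp add: algebra_simps scaleR_add_left[symmetric])
  then show ?thesis using convex_onD[OF assms, of "1/2" "z + h" "z - h"] by simp
qed

lemma tangent_below_of_convex:
  assumes td: "twice_diff V G H" and cv: "convex_on UNIV V"
  shows "V b + G b \<bullet> (a - b) \<le> V a"
proof -
  have "convex_on UNIV (\<lambda>t. V (b + t *\<^sub>R (a - b)))"
  proof (rule convex_onI)
    fix t x y :: real assume "0 < t" "t < 1"
    moreover have "b + ((1 - t) *\<^sub>R x + t *\<^sub>R y) *\<^sub>R (a - b) =
       (1 - t) *\<^sub>R (b + x *\<^sub>R (a - b)) + t *\<^sub>R (b + y *\<^sub>R (a - b))"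
      by (simp add: algebra_simps)
    ultimately show "V (b + ((1 - t) *\<^sub>R x + t *\<^sub>R y) *\<^sub>R (a - b)) \<le>
       (1 - t) * V (b + x *\<^sub>R (a - b)) + t * V (b + y *\<^sub>R (a - b))"
      using convex_onD[OF cv] by auto
  qed auto
  from convex_on_imp_above_tangent[OF this _ _ _ has_field_derivative_at_within, of 0 1, OF _ _ _ twice_diff_line(1)[OF td]]
  show ?thesis by simp
qed

text \<open>
  After subtracting \<open>m/2 |z|\<^sup>2\<close> this is the case \<open>m = 0\<close>, that is, the equivalence of a positive
  semidefinite Hessian, convexity and midpoint convexity. The parallelogram law turns midpoint
  convexity of the shifted function into the stated second difference.
\<close>

lemma hessian_lower_bound_iff_second_difference:
  assumes td: "twice_diff V G H"
  shows "(\<forall>z v. m * (v \<bullet> v) \<le> H z v \<bullet> v) \<longleftrightarrow>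
         (\<forall>z h. 2 * V z + m * (h \<bullet> h) \<le> V (z + h) + V (z - h))"
proof -
  let ?W = "\<lambda>z. V z - m / 2 * (norm z)\<^sup>2"
  note td' = twice_diff_sub_quadratic[OF td, of m]
  have "(\<forall>z v. m * (v \<bullet> v) \<le> H z v \<bullet> v) \<longleftrightarrow> (\<forall>z v. 0 \<le> (H z v - m *\<^sub>R v) \<bullet> v)"
    by (simp add: inner_diff_left)
  also have "\<dots> \<longleftrightarrow> (\<forall>z h. 2 * ?W z \<le> ?W (z + h) + ?W (z - h))"
    using convex_of_hessian_nonneg[OF td', THEN midpoint_of_convex]
      hessian_nonneg_of_midpoint_convex[OF td'] by blast
  also have "\<dots> \<longleftrightarrow> (\<forall>z h. 2 * V z + m * (h \<bullet> h) \<le> V (z + h) + V (z - h))"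
    by (simp add: power2_norm_eq_inner algebra_simps inner_commute)
  finally show ?thesis .
qed

lemma hessian_upper_bound_iff_second_difference:
  assumes td: "twice_diff V G H"
  shows "(\<forall>z v. H z v \<bullet> v \<le> M * (v \<bullet> v)) \<longleftrightarrow>
         (\<forall>z h. V (z + h) + V (z - h) \<le> 2 * V z + M * (h \<bullet> h))"
  using hessian_lower_bound_iff_second_difference[OF twice_diff_uminus[OF td], of "- M"]
  by (simp add: algebra_simps)

lemma smooth_upper_bound:
  assumes td: "twice_diff V G H" and up: "\<And>z v. H z v \<bullet> v \<le> L * (v \<bullet> v)"
  shows "V a \<le> V b + G b \<bullet> (a - b) + L / 2 * (norm (a - b))\<^sup>2"
proof -
  note td' = twice_diff_sub_quadratic[OF twice_diff_uminus[OF td], of "- L"]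
  have "convex_on UNIV (\<lambda>z. - V z - (- L) / 2 * (norm z)\<^sup>2)"
    by (rule convex_of_hessian_nonneg[OF td']) (use up in \<open>simp add: inner_diff_left\<close>)
  from tangent_below_of_convex[OF td' this, of b a] show ?thesis
    by (simp add: power2_norm_eq_inner algebra_simps inner_commute)
qed

text \<open>
  One gradient step of length \<open>1 / L\<close> decreases \<open>V\<close> by at least \<open>|G z|\<^sup>2 / (2 L)\<close>, and \<open>V\<close> cannot
  fall below \<open>B\<close>.
\<close>

lemma gradient_sq_le:
  assumes td: "twice_diff V G H" and up: "\<And>z v. H z v \<bullet> v \<le> L * (v \<bullet> v)"
    and L: "0 < L" and low: "\<And>z. B \<le> V z"
  shows "(norm (G z))\<^sup>2 \<le> 2 * L * (V z - B)"
proof -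
  have "B \<le> V (z - (1 / L) *\<^sub>R G z)" by (rule low)
  also have "\<dots> \<le> V z + G z \<bullet> (- ((1 / L) *\<^sub>R G z)) + L / 2 * (norm ((1 / L) *\<^sub>R G z))\<^sup>2"
    using smooth_upper_bound[OF td up, of "z - (1 / L) *\<^sub>R G z" z] by simp
  also have "\<dots> = V z - (norm (G z))\<^sup>2 / (2 * L)"
    using L by (simp add: dot_square_norm power2_eq_square field_simps)
  finally show ?thesis using L by (simp add: field_simps)
qed

text \<open>
  Subtracting from \<open>V\<close> its tangent at \<open>b\<close> gives a function that is minimal at \<open>b\<close>, so
  \<open>gradient_sq_le\<close> bounds \<open>|G a - G b|\<^sup>2\<close> by the gap to the tangent, which the upper Hessian bound
  controls by \<open>L/2 |a - b|\<^sup>2\<close>. In the limit \<open>a \<rightarrow> b\<close> this turns a bound on the quadratic form of \<open>H\<close>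
  into an operator norm bound.
\<close>

lemma gradient_lipschitz:
  assumes td: "twice_diff V G H" and up: "\<And>z v. H z v \<bullet> v \<le> L * (v \<bullet> v)"
    and L: "0 < L" and cv: "convex_on UNIV V"
  shows "norm (G a - G b) \<le> L * norm (a - b)"
proof -
  have "(norm (G a - G b))\<^sup>2 \<le> 2 * L * ((V a - G b \<bullet> a) - (V b - G b \<bullet> b))"
    using tangent_below_of_convex[OF td cv, of b]
    by (intro gradient_sq_le[OF twice_diff_sub_linear[OF td] up L]) (auto simp: algebra_simps)
  also have "\<dots> \<le> 2 * L * (L / 2 * (norm (a - b))\<^sup>2)"
    using smooth_upper_bound[OF td up, of a b] L by (intro mult_left_mono) (auto simp: algebra_simps)
  also have "\<dots> = (L * norm (a - b))\<^sup>2" by (simp add: power2_eq_square)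
  finally show ?thesis by (rule power2_le_imp_le) (use L in auto)
qed

lemma hessian_norm_le:
  assumes td: "twice_diff V G H" and up: "\<And>z v. H z v \<bullet> v \<le> L * (v \<bullet> v)"
    and L: "0 < L" and cv: "convex_on UNIV V"
  shows "norm (H z v) \<le> L * norm v"
proof -
  have lin: "linear (H z)" using twice_diffD(2)[OF td] has_derivative_linear by blast
  show ?thesis
  proof (cases "v = 0")
    case True
    then show ?thesis using linear_0[OF lin] by simp
  next
    case False
    show ?thesis
    proof (rule field_le_epsilon)
      fix e :: real assume "0 < e"
      then have "0 < e / norm v" using False by simp
      then obtain d where d: "0 < d"
        "\<And>y. norm (y - z) < d \<Longrightarrow> norm (G y - G z - H z (y - z)) \<le> e / norm v * norm (y - z)"
        using twice_diffD(2)[OF td, of z] unfolding has_derivative_at_alt by blast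
      define t where "t = d / (2 * norm v)"
      have t: "0 < t" "norm (t *\<^sub>R v) < d" using d(1) False by (auto simp: t_def)
      have "norm (H z (t *\<^sub>R v)) \<le> norm (G (z + t *\<^sub>R v) - G z)
          + norm (G (z + t *\<^sub>R v) - G z - H z (t *\<^sub>R v))"
        using norm_triangle_ineq4[of "G (z + t *\<^sub>R v) - G z" "G (z + t *\<^sub>R v) - G z - H z (t *\<^sub>R v)"]
        by simp
      also have "\<dots> \<le> L * norm (t *\<^sub>R v) + e / norm v * norm (t *\<^sub>R v)"
        using d(2)[of "z + t *\<^sub>R v"] t gradient_lipschitz[OF td up L cv, of "z + t *\<^sub>R v" z]
        by (intro add_mono) auto
      finally have "t * norm (H z v) \<le> t * (L * norm v + e)"
        using t False by (simp add: linear_cmul[OF lin] algebra_simps)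
      then show "norm (H z v) \<le> L * norm v + e" using t by simp
    qed
  qed
qed

lemma gradient_eqI:
  assumes g: "GDERIV V z :> g"
  shows "gradient V z = g"
  unfolding gradient_def
proof (rule the_equality)
  show "GDERIV V z :> g" by (rule g)
  fix g' assume "GDERIV V z :> g'"
  then have "(\<lambda>h. h \<bullet> g') = (\<lambda>h. h \<bullet> g)"
    using g unfolding gderiv_def by (rule has_derivative_unique)
  then show "g' = g" by (metis inner_commute vector_eq_ldot)
qed

lemma twice_diff_gradient_hessian:
  assumes "twice_diff V G H"
  shows "gradient V = G" "hessian V = H"
proof -
  have "gradient V z = G z" for z
    using twice_diffD(1)[OF assms] by (intro gradient_eqI) (simp add: gderiv_def inner_commute)
  then show *: "gradient V = G" by blast
  have "hessian V z = H z" for z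
    unfolding hessian_def * using frechet_derivative_at[OF twice_diffD(2)[OF assms]] by simp
  then show "hessian V = H" by blast
qed

lemma C2_imp_twice_diff:
  assumes "C2 V"
  shows "twice_diff V (gradient V) (hessian V)"
  unfolding twice_diff_def
proof safe
  fix z
  obtain D where D: "(V has_derivative D) (at z)" using assms unfolding C2_def differentiable_def by blast
  have "D h = adjoint D 1 \<bullet> h" for h
    using adjoint_works[OF has_derivative_linear[OF D], of h 1] by (simp add: inner_commute)
  then have "GDERIV V z :> adjoint D 1"
    unfolding gderiv_def using D by (metis (no_types, lifting) ext inner_commute)
  from this gradient_eqI[OF this] show "(V has_derivative (\<lambda>h. gradient V z \<bullet> h)) (at z)"
    by (simp add: gderiv_def inner_commute)
  show "(gradient V has_derivative hessian V z) (at z)"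
    unfolding hessian_def using assms by (simp add: C2_def frechet_derivative_works[symmetric])
qed

lemma twice_diff_imp_C2:
  assumes td: "twice_diff V G H" and "\<And>h. continuous_on UNIV (\<lambda>z. H z h)"
  shows "C2 V"
  unfolding C2_def twice_diff_gradient_hessian[OF td]
  using assms twice_diffD[OF td] by (auto simp: differentiable_def)

section \<open>Linear growth of convex functions with integrable exponential\<close>

text \<open>
  A convex set that contains a ball around \<open>0\<close> and a far point \<open>p\<close> contains balls of half the
  radius around every point of the first half of the segment from \<open>0\<close> to \<open>p\<close>; placing their
  centres at distance \<open>r\<close> makes \<open>n\<close> of them disjoint. So long convex sets have large volume.
\<close>

lemma convex_superset_ball_chain:
  fixes K :: "'a::euclidean_space set"
  assumes K: "convex K" "K \<in> sets borel" and r: "0 < r" "ball 0 r \<subseteq> K"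
    and p: "p \<in> K" "2 * (real n * r) \<le> norm p"
  shows "of_nat n * emeasure lborel (ball (0::'a) (r / 2)) \<le> emeasure lborel K"
proof (cases "n = 0")
  case False
  then have p0: "0 < norm p" using p(2) r(1) 
    by (smt (verit) mult_pos_pos of_nat_0_less_iff not_gr_zero)
  define q where "q j = (real j * r / norm p) *\<^sub>R p" for j :: nat
  have sub: "ball (q j) (r / 2) \<subseteq> K" if j: "j < n" for j
  proof
    fix w assume w: "w \<in> ball (q j) (r / 2)"
    define s where "s = real j * r / norm p"
    have "real j * r \<le> real n * r" using j r by simp
    then have "real j * r \<le> norm p / 2" using p(2) by linarith
    then have s: "0 \<le> s" "s \<le> 1 / 2" using p0 r by (simp_all add: s_def divide_simps)
    define u where "u = (1 / (1 - s)) *\<^sub>R (w - q j)"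
    have "norm u = norm (w - q j) / (1 - s)" using s by (simp add: u_def)
    also have "\<dots> < r"
    proof -
      have "norm (w - q j) < r / 2" using w by (simp add: dist_norm norm_minus_commute)
      also have "\<dots> \<le> r * (1 - s)" using s r by (simp add: field_simps)
      finally show ?thesis using s by (simp add: field_simps)
    qed
    finally have "u \<in> K" using r by auto
    then have "(1 - s) *\<^sub>R u + s *\<^sub>R p \<in> K" using convexD[OF K(1) _ p(1)] s by simp
    moreover have "(1 - s) *\<^sub>R u = w - q j" using s unfolding u_def by simp
    moreover have "q j = s *\<^sub>R p" by (simp only: q_def s_def)
    ultimately show "w \<in> K" by simp
  qed
  have disj: "disjoint_family_on (\<lambda>j. ball (q j) (r / 2)) {..<n}"
    unfolding disjoint_family_on_def
  proof (intro ballI impI)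
    fix i j :: nat assume ij: "i \<noteq> j"
    have "norm (q i - q j) = \<bar>real i - real j\<bar> * r"
    proof -
      have "q i - q j = ((real i - real j) * r / norm p) *\<^sub>R p"
        by (simp add: q_def scaleR_diff_left[symmetric] diff_divide_distrib left_diff_distrib)
      then show ?thesis using p0 r by (simp add: abs_mult)
    qed
    moreover have "1 \<le> \<bar>real i - real j\<bar>" using ij by linarith
    ultimately have "r \<le> dist (q i) (q j)" using r by (simp add: dist_norm)
    then show "ball (q i) (r / 2) \<inter> ball (q j) (r / 2) = {}"
      by (intro disjoint_ballI) simp
  qed
  have ball_eq: "emeasure lborel (ball (q j) (r / 2)) = emeasure lborel (ball (0::'a) (r / 2))" for j
    using emeasure_lborel_ball_finite[of "q j" "r/2"] 
    by (simp add: emeasure_ball r(1) less_imp_le)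
  have "of_nat n * emeasure lborel (ball (0::'a) (r / 2)) = (\<Sum>j<n. emeasure lborel (ball (q j) (r / 2)))"
    by (simp add: ball_eq)
  also have "\<dots> = emeasure lborel (\<Union>j<n. ball (q j) (r / 2))"
    using disj by (intro sum_emeasure) auto
  also have "\<dots> \<le> emeasure lborel K" using sub K(2) by (intro emeasure_mono) auto
  finally show ?thesis .
qed simp

text \<open>
  The sublevel set \<open>V \<le> V 0 + 1\<close> has finite volume because \<open>exp (- V)\<close> is bounded below on it, so it
  lies in a ball of some radius \<open>R\<close>. Along each ray from \<open>0\<close> the potential thus gains at least \<open>1\<close>
  by distance \<open>R\<close>, and by convexity it keeps growing with slope at least \<open>1 / R\<close>.
\<close>

lemma convex_integrable_growth:
  fixes V :: "'a::euclidean_space \<Rightarrow> real"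
  assumes cv: "convex_on UNIV V" and cont: "continuous_on UNIV V"
    and fin: "(\<integral>\<^sup>+z. ennreal (exp (- V z)) \<partial>lborel) < \<infinity>"
  obtains a b where "0 < a" "\<And>z. a * norm z - b \<le> V z"
proof -
  define c where "c = V 0 + 1"
  define K where "K = {z. V z \<le> c}"
  have Kcv: "convex K"
  proof (rule convexI)
    fix x y u v assume *: "x \<in> K" "y \<in> K" "0 \<le> u" "0 \<le> v" "u + v = (1::real)"
    have "V (u *\<^sub>R x + v *\<^sub>R y) \<le> u * V x + v * V y"
      using cv * by (simp add: convex_on_def)
    also have "\<dots> \<le> u * c + v * c" using * by (intro add_mono mult_left_mono) (auto simp: K_def)
    also have "\<dots> = c" using * by (simp add: distrib_right[symmetric])
    finally show "u *\<^sub>R x + v *\<^sub>R y \<in> K" by (simp add: K_def)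
  qed
  have Kmeas: "K \<in> sets borel"
    unfolding K_def using cont by (intro borel_closed closed_Collect_le) auto
  have "open (V -` {..<c})" using cont by (intro open_vimage) auto
  moreover have "0 \<in> V -` {..<c}" by (simp add: c_def)
  ultimately obtain r where r: "0 < r" "ball 0 r \<subseteq> V -` {..<c}" by (meson openE)
  then have rK: "ball 0 r \<subseteq> K" by (auto simp: K_def)
  have "emeasure lborel K < \<infinity>"
  proof -
    have "ennreal (exp (- c)) * emeasure lborel K = (\<integral>\<^sup>+z. ennreal (exp (- c)) * indicator K z \<partial>lborel)"
      using Kmeas by (simp add: nn_integral_cmult)
    also have "\<dots> \<le> (\<integral>\<^sup>+z. ennreal (exp (- V z)) \<partial>lborel)"
      by (intro nn_integral_mono) (auto simp: indicator_def K_def intro!: ennreal_leI)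
    finally have "ennreal (exp (- c)) * emeasure lborel K < \<infinity>" using fin by simp
    then show ?thesis by (auto simp: ennreal_mult_less_top)
  qed
  then obtain k where k: "emeasure lborel K = ennreal k" "0 \<le> k"
    by (metis ennreal_cases infinity_ennreal_def less_irrefl)
  have ballpos: "emeasure lborel (ball (0::'a) (r / 2)) > 0" 
    using r by (simp add: emeasure_ball)
  obtain \<beta> where \<beta>: "emeasure lborel (ball (0::'a) (r / 2)) = ennreal \<beta>" "0 < \<beta>"
    using ballpos emeasure_lborel_ball_finite[of "0::'a" "r/2"]
    by (metis ennreal_cases ennreal_eq_0_iff infinity_ennreal_def less_irrefl not_le)
  \<comment> \<open>so many balls that their total volume exceeds that of \<open>K\<close>\<close>
  obtain n where n: "emeasure lborel K < of_nat n * emeasure lborel (ball (0::'a) (r / 2))"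
  proof -
    obtain n where "k / \<beta> < real n" using reals_Archimedean2 by blast
    then have "k < real n * \<beta>" using \<beta> by (simp add: field_simps)
    then have "emeasure lborel K < of_nat n * emeasure lborel (ball (0::'a) (r / 2))"
      using k \<beta> by (simp add: ennreal_of_nat_eq_real_of_nat ennreal_mult[symmetric] ennreal_less_iff)
    then show thesis by (rule that)
  qed
  define R where "R = 2 * (real n * r)"
  have npos: "0 < n" using n by (cases n) auto
  then have R: "0 < R" using r by (simp add: R_def)
  have Kbd: "norm p < R" if "p \<in> K" for p
    using convex_superset_ball_chain[OF Kcv Kmeas r(1) rK that, of n] n by (force simp: R_def)
  have far: "V 0 + norm z / R \<le> V z" if z: "R \<le> norm z" for z
  proof -
    define t where "t = R / norm z"
    have "0 < norm z" using R z by linarith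
    then have t: "0 < t" "t \<le> 1" using R z by (simp_all add: t_def)
    have "norm (t *\<^sub>R z) = R" using R z by (auto simp: t_def)
    then have "t *\<^sub>R z \<notin> K" using Kbd by force
    then have "V 0 + 1 < V (t *\<^sub>R z)" by (simp add: K_def c_def)
    also have "\<dots> \<le> (1 - t) * V 0 + t * V z" using convex_onD[OF cv, of t 0 z] t by simp
    finally have "1 < t * (V z - V 0)" by (simp add: algebra_simps)
    then have "1 / t < V z - V 0" using t by (simp add: field_simps)
    then show ?thesis by (simp add: t_def)
  qed
  have "compact (V ` cball 0 R)"
    using cont by (intro compact_continuous_image continuous_on_subset[OF cont]) auto
  then obtain B where B: "\<And>z. norm z \<le> R \<Longrightarrow> \<bar>V z\<bar> \<le> B"
    using compact_imp_bounded bounded_real by (metis imageI mem_cball_0 bounded_iff real_norm_def)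
  show thesis
  proof (rule that[of "1 / R" "B + 1"])
    show "0 < 1 / R" using R by simp
    have V0: "\<bar>V 0\<bar> \<le> B" using B[of 0] R by simp
    fix z show "1 / R * norm z - (B + 1) \<le> V z"
    proof (cases "R \<le> norm z")
      case True
      then show ?thesis using far[OF True] V0 by simp
    next
      case False
      then have "norm z / R \<le> 1" using R by simp
      then show ?thesis using B[of z] False by simp
    qed
  qed
qed

text \<open>
  Since \<open>|x|\<close> is at least the average of the coordinates \<open>|x \<bullet> b|\<close>, the integrand is dominated by
  a product of one-dimensional Laplace densities.
\<close>

lemma integrable_exp_neg_norm:
  assumes a: "0 < a"
  shows "integrable lborel (\<lambda>x::'a::euclidean_space. exp (- (a * norm x)))"
proof -
  define c where "c = a / real DIM('a)"
  have c: "0 < c" using a by (simp add: c_def)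
  have line: "(\<integral>\<^sup>+t. ennreal (exp (- (c * \<bar>t\<bar>))) \<partial>lborel) < \<infinity>"
  proof -
    interpret E: prob_space "density lborel (exponential_density c)"
      using c by (rule prob_space_exponential_density)
    have E: "(\<integral>\<^sup>+t. ennreal (exponential_density c t) \<partial>lborel) = 1"
      using E.emeasure_space_1 by (simp add: emeasure_density)
    have E': "(\<integral>\<^sup>+t. ennreal (exponential_density c (- t)) \<partial>lborel) = 1"
      using E nn_integral_real_affine[of "\<lambda>t. ennreal (exponential_density c t)" "-1" 0] by simp
    have "(\<integral>\<^sup>+t. ennreal (exp (- (c * \<bar>t\<bar>))) \<partial>lborel) \<le>
        (\<integral>\<^sup>+t. ennreal (1 / c) * (ennreal (exponential_density c t) + ennreal (exponential_density c (- t))) \<partial>lborel)"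
    proof (rule nn_integral_mono)
      fix t :: real
      have nn: "0 \<le> exponential_density c t" "0 \<le> exponential_density c (- t)"
        using c by (auto simp: exponential_density_def)
      have "exp (- (c * \<bar>t\<bar>)) \<le> 1 / c * (exponential_density c t + exponential_density c (- t))"
        using c by (auto simp: exponential_density_def field_simps abs_if)
      then show "ennreal (exp (- (c * \<bar>t\<bar>))) \<le>
          ennreal (1 / c) * (ennreal (exponential_density c t) + ennreal (exponential_density c (- t)))"
        using c nn by (simp add: ennreal_mult[symmetric] ennreal_plus[symmetric] ennreal_leI
            del: ennreal_plus)
    qed
    also have "\<dots> = ennreal (1 / c) * (1 + 1)"
      by (simp add: nn_integral_cmult nn_integral_add E E')
    also have "\<dots> < \<infinity>" by (simp add: ennreal_mult_less_top)
    finally show ?thesis .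
  qed
  have "(\<integral>\<^sup>+x. ennreal (exp (- (a * norm (x::'a)))) \<partial>lborel) \<le>
      (\<integral>\<^sup>+x. (\<Prod>b\<in>(Basis::'a set). ennreal (exp (- (c * \<bar>x \<bullet> b\<bar>)))) \<partial>lborel)"
  proof (rule nn_integral_mono)
    fix x :: 'a
    have "(\<Sum>b\<in>Basis. \<bar>x \<bullet> b\<bar>) \<le> real DIM('a) * norm x"
      using sum_bounded_above[of Basis "\<lambda>b. \<bar>x \<bullet> b\<bar>" "norm x"] Basis_le_norm by auto
    then have "c * (\<Sum>b\<in>Basis. \<bar>x \<bullet> b\<bar>) \<le> a * norm x"
      using a by (simp add: c_def field_simps)
    then have "exp (- (a * norm x)) \<le> (\<Prod>b\<in>Basis. exp (- (c * \<bar>x \<bullet> b\<bar>)))"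
      by (simp add: exp_sum[symmetric] sum_negf sum_distrib_left)
    then show "ennreal (exp (- (a * norm x))) \<le> (\<Prod>b\<in>Basis. ennreal (exp (- (c * \<bar>x \<bullet> b\<bar>))))"
      by (simp add: prod_ennreal ennreal_leI)
  qed
  also have "\<dots> = (\<Prod>b\<in>(Basis::'a set). \<integral>\<^sup>+t. ennreal (exp (- (c * \<bar>t\<bar>))) \<partial>lborel)"
    by (rule nn_integral_lborel_prod) auto
  also have "\<dots> < \<infinity>" using line by (simp add: power_less_top_ennreal)
  finally show ?thesis by (intro integrableI_bounded) auto
qed

section \<open>Differentiation under the integral sign\<close>

text \<open>
  The difference quotients converge to \<open>0\<close> pointwise, and the mean value inequality dominates them
  by \<open>2 g\<close>.
\<close>

lemma has_derivative_integral:
  fixes F :: "'a \<Rightarrow> 'b::real_normed_vector \<Rightarrow> 'c::{banach, second_countable_topology}"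
  assumes int: "\<And>y. integrable M (\<lambda>x. F x y)"
    and der: "\<And>x y. x \<in> space M \<Longrightarrow> (F x has_derivative F' x y) (at y)"
    and meas: "\<And>y h. (\<lambda>x. F' x y h) \<in> borel_measurable M"
    and bound: "\<And>x y h. x \<in> space M \<Longrightarrow> norm (F' x y h) \<le> g x * norm h"
    and g: "integrable M g" and g0: "\<And>x. x \<in> space M \<Longrightarrow> 0 \<le> g x"
  shows "((\<lambda>y. \<integral>x. F x y \<partial>M) has_derivative (\<lambda>h. \<integral>x. F' x y h \<partial>M)) (at y)"
proof -
  have int': "integrable M (\<lambda>x. F' x y h)" for h
    using meas bound g0
    by (intro Bochner_Integration.integrable_bound[OF integrable_mult_left[OF g, of "norm h"]])
       (auto intro!: AE_I2)
  have lin: "linear (F' x y)" if "x \<in> space M" for x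
    using der[OF that] has_derivative_linear by blast
  have bl: "bounded_linear (\<lambda>h. \<integral>x. F' x y h \<partial>M)"
  proof (rule bounded_linear_intro)
    fix h k :: 'b and s :: real
    have "(\<integral>x. F' x y (h + k) \<partial>M) = (\<integral>x. F' x y h + F' x y k \<partial>M)"
      by (intro Bochner_Integration.integral_cong) (auto simp: linear_add[OF lin])
    then show "(\<integral>x. F' x y (h + k) \<partial>M) = (\<integral>x. F' x y h \<partial>M) + (\<integral>x. F' x y k \<partial>M)"
      using int' by simp
    have "(\<integral>x. F' x y (s *\<^sub>R h) \<partial>M) = (\<integral>x. s *\<^sub>R F' x y h \<partial>M)"
      by (intro Bochner_Integration.integral_cong) (auto simp: linear_cmul[OF lin])
    then show "(\<integral>x. F' x y (s *\<^sub>R h) \<partial>M) = s *\<^sub>R (\<integral>x. F' x y h \<partial>M)" by simp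
    have "norm (\<integral>x. F' x y h \<partial>M) \<le> (\<integral>x. norm (F' x y h) \<partial>M)"
      by (rule integral_norm_bound)
    also have "\<dots> \<le> (\<integral>x. g x * norm h \<partial>M)"
      using bound int' g by (intro integral_mono) auto
    finally have "norm (\<integral>x. F' x y h \<partial>M) \<le> (\<integral>x. g x * norm h \<partial>M)" .
    then show "norm (\<integral>x. F' x y h \<partial>M) \<le> norm h * (\<integral>x. g x \<partial>M)" by (simp add: mult.commute)
  qed
  let ?D = "\<lambda>h. \<integral>x. F' x y h \<partial>M"
  have lip: "norm (F x (y + h) - F x y) \<le> g x * norm h" if x: "x \<in> space M" for x h
  proof -
    have "onorm (F' x z) \<le> g x" for z
      using bound[OF x] g0[OF x] by (intro onorm_bound) auto
    then have "norm (F x (y + h) - F x y) \<le> g x * norm ((y + h) - y)"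
      using der[OF x] by (intro differentiable_bound[of UNIV]) auto
    then show ?thesis by simp
  qed
  have "(\<lambda>h. norm ((\<integral>x. F x (y + h) \<partial>M) - (\<integral>x. F x y \<partial>M) - ?D h) / norm h) \<midarrow>0\<rightarrow> 0"
    unfolding tendsto_at_iff_sequentially comp_def
  proof safe
    fix X :: "nat \<Rightarrow> 'b" assume X: "\<forall>i. X i \<in> UNIV - {0}" "X \<longlonglongrightarrow> 0"
    define S where "S n x = (F x (y + X n) - F x y - F' x y (X n)) /\<^sub>R norm (X n)" for n x
    have Xn: "norm (X n) > 0" for n using X(1) by auto
    have "(\<lambda>n. \<integral>x. S n x \<partial>M) \<longlonglongrightarrow> (\<integral>x. 0 \<partial>M)"
    proof (rule integral_dominated_convergence[where w="\<lambda>x. 2 * g x"])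
      show "S n \<in> borel_measurable M" for n
        using int int' unfolding S_def
        by (intro borel_measurable_scaleR borel_measurable_diff borel_measurable_const
            borel_measurable_integrable) auto
      show "integrable M (\<lambda>x. 2 * g x)" using g by simp
      show "AE x in M. (\<lambda>n. S n x) \<longlonglongrightarrow> 0"
      proof (rule AE_I2)
        fix x assume x: "x \<in> space M"
        have "(\<lambda>h. norm (F x (y + h) - F x y - F' x y h) / norm h) \<midarrow>0\<rightarrow> 0"
          using der[OF x, of y] unfolding has_derivative_at by blast
        then have "(\<lambda>n. norm (F x (y + X n) - F x y - F' x y (X n)) / norm (X n)) \<longlonglongrightarrow> 0"
          using X unfolding tendsto_at_iff_sequentially comp_def by blast
        then have "(\<lambda>n. norm (S n x)) \<longlonglongrightarrow> 0" by (simp add: S_def divide_inverse mult.commute)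
        then show "(\<lambda>n. S n x) \<longlonglongrightarrow> 0" by (rule tendsto_norm_zero_cancel)
      qed
      show "AE x in M. norm (S n x) \<le> 2 * g x" for n
      proof (rule AE_I2)
        fix x assume x: "x \<in> space M"
        have "norm (F x (y + X n) - F x y - F' x y (X n)) \<le> g x * norm (X n) + g x * norm (X n)"
          by (rule order_trans[OF norm_triangle_ineq4 add_mono[OF lip[OF x] bound[OF x]]])
        then show "norm (S n x) \<le> 2 * g x" using Xn[of n]
            by (simp add: S_def divide_inverse_commute[symmetric] pos_divide_le_eq)
      qed
    qed simp
    then have "(\<lambda>n. norm (\<integral>x. S n x \<partial>M)) \<longlonglongrightarrow> 0" by (simp add: tendsto_norm_zero)
    moreover have "norm (\<integral>x. S n x \<partial>M) =
        norm ((\<integral>x. F x (y + X n) \<partial>M) - (\<integral>x. F x y \<partial>M) - ?D (X n)) / norm (X n)" for n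
      unfolding S_def using int int' by (simp add: divide_inverse mult.commute)
    ultimately show "(\<lambda>n. norm ((\<integral>x. F x (y + X n) \<partial>M) - (\<integral>x. F x y \<partial>M) - ?D (X n))
        / norm (X n)) \<longlonglongrightarrow> 0" by simp
  qed
  then show ?thesis using bl unfolding has_derivative_at by blast
qed

lemma continuous_on_integral_dominated:
  fixes F :: "'a \<Rightarrow> 'b::first_countable_topology \<Rightarrow> 'c::{banach, second_countable_topology}"
  assumes cont: "\<And>x. x \<in> space M \<Longrightarrow> continuous_on UNIV (F x)"
    and meas: "\<And>y. (\<lambda>x. F x y) \<in> borel_measurable M"
    and bound: "\<And>x y. x \<in> space M \<Longrightarrow> norm (F x y) \<le> g x"
    and g: "integrable M g"
  shows "continuous_on UNIV (\<lambda>y. \<integral>x. F x y \<partial>M)"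
  unfolding continuous_on_def
proof safe
  fix y
  show "((\<lambda>y. \<integral>x. F x y \<partial>M) \<longlongrightarrow> (\<integral>x. F x y \<partial>M)) (at y)"
    unfolding tendsto_at_iff_sequentially comp_def
  proof safe
    fix X :: "nat \<Rightarrow> 'b" assume X: "\<forall>i. X i \<in> UNIV - {y}" "X \<longlonglongrightarrow> y"
    show "(\<lambda>n. \<integral>x. F x (X n) \<partial>M) \<longlonglongrightarrow> (\<integral>x. F x y \<partial>M)"
    proof (rule integral_dominated_convergence[where w=g])
      show "AE x in M. (\<lambda>n. F x (X n)) \<longlonglongrightarrow> F x y"
        using cont X(2) by (intro AE_I2) (auto intro: continuous_on_tendsto_compose[of UNIV])
    qed (use meas bound g in auto)
  qed
qed

section \<open>Regularity of the marginal potential\<close>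

text \<open>
  A convex potential with bounded Hessian and linear growth. The growth bound stands for
  integrability of \<open>exp (- V)\<close>; it follows from it by \<open>convex_integrable_growth\<close>.
\<close>

locale smooth_log_concave_joint =
  fixes V :: "'x::euclidean_space \<times> 'y::euclidean_space \<Rightarrow> real"
    and G :: "'x \<times> 'y \<Rightarrow> 'x \<times> 'y" and H :: "'x \<times> 'y \<Rightarrow> 'x \<times> 'y \<Rightarrow> 'x \<times> 'y"
    and L a b :: real
  assumes td: "twice_diff V G H"
    and cont_H: "continuous_on UNIV (\<lambda>z. H z h)"
    and cv: "convex_on UNIV V"
    and up: "H z v \<bullet> v \<le> L * (v \<bullet> v)" and L: "0 < L"
    and a: "0 < a" and growth: "a * norm z - b \<le> V z"
begin

definition P :: "'y \<Rightarrow> real" where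
  "P y = (\<integral>x. exp (- V (x, y)) \<partial>lborel)"

text \<open>
  An integrable function of \<open>x\<close> alone that dominates \<open>exp (- V (x, y))\<close> and its first two derivatives
  in \<open>y\<close>. The constant is the one produced by \<open>weight_bound\<close>.
\<close>

definition envelope :: "'x \<Rightarrow> real" where
  "envelope x = 2 * (1 + 2 * L) * exp b * exp (- (a / 2 * norm x))"

lemma envelope_integrable: "integrable lborel envelope"
  unfolding envelope_def using a by (intro integrable_mult_right integrable_exp_neg_norm) simp

lemma envelope_nonneg: "0 \<le> envelope x"
  unfolding envelope_def using L by auto

text \<open>
  The squared gradient is at most linear in \<open>u = V + b\<close>, and a linear factor costs only half of the
  exponent: \<open>1 + u / 2 \<le> exp (u / 2)\<close>. The other half still decays like \<open>exp (- a |x| / 2)\<close>.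
\<close>

lemma weight_bound: "(1 + L + (norm (G (x, y)))\<^sup>2) * exp (- V (x, y)) \<le> envelope x"
proof -
  define u where "u = V (x, y) + b"
  have low: "- b \<le> V z" for z using growth[of z] a by (smt (verit) mult_nonneg_nonneg norm_ge_zero)
  have u0: "0 \<le> u" using low by (simp add: u_def add_increasing) (smt (verit) low)
  have "norm x \<le> norm (x, y)" by (rule norm_fst_le)
  then have "a * norm x \<le> a * norm (x, y)" using a by simp
  then have ux: "a * norm x \<le> u" using growth[of "(x, y)"] by (simp add: u_def)
  have "(norm (G (x, y)))\<^sup>2 \<le> 2 * L * u"
    using gradient_sq_le[OF td up L low, of "(x, y)"] by (simp add: u_def)
  then have "1 + L + (norm (G (x, y)))\<^sup>2 \<le> (1 + 2 * L) * (2 * (1 + u / 2))"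
    using L u0 by (simp add: algebra_simps)
  also have "\<dots> \<le> (1 + 2 * L) * (2 * exp (u / 2))"
    using L exp_ge_add_one_self[of "u / 2"] by (intro mult_left_mono) auto
  finally have "(1 + L + (norm (G (x, y)))\<^sup>2) * exp (- V (x, y))
      \<le> (1 + 2 * L) * (2 * exp (u / 2)) * exp (b - u)"
    by (simp add: u_def mult_right_mono)
  also have "\<dots> = 2 * (1 + 2 * L) * exp b * exp (- (u / 2))"
    by (simp add: exp_diff exp_minus field_simps exp_add[symmetric])
  also have "\<dots> \<le> envelope x" unfolding envelope_def using L ux by (intro mult_left_mono) auto
  finally show ?thesis .
qed

lemma continuous_V: "continuous_on UNIV V"
  using twice_diffD(1)[OF td] by (meson has_derivative_continuous continuous_at_imp_continuous_on)

lemma continuous_G: "continuous_on UNIV G"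
  using twice_diffD(2)[OF td] by (meson has_derivative_continuous continuous_at_imp_continuous_on)

lemma continuous_on_along [continuous_intros]:
  assumes f: "continuous_on A f"
  shows "continuous_on A (\<lambda>x. V (f x))" "continuous_on A (\<lambda>x. G (f x))" "continuous_on A (\<lambda>x. H (f x) h)"
  using continuous_on_compose2[OF continuous_V f] continuous_on_compose2[OF continuous_G f]
    continuous_on_compose2[OF cont_H f] by auto

text \<open>
  The functions \<open>slice_grad x\<close> and \<open>slice_hess x\<close> are the gradient and the second derivative of
  \<open>y \<mapsto> exp (- V (x, y))\<close>.
\<close>

definition slice_grad :: "'x \<Rightarrow> 'y \<Rightarrow> 'y" where
  "slice_grad x y = - (exp (- V (x, y)) *\<^sub>R snd (G (x, y)))"

definition slice_hess :: "'x \<Rightarrow> 'y \<Rightarrow> 'y \<Rightarrow> 'y" where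
  "slice_hess x y h = exp (- V (x, y)) *\<^sub>R ((snd (G (x, y)) \<bullet> h) *\<^sub>R snd (G (x, y)) - snd (H (x, y) (0, h)))"

lemma measurable_slices [measurable]:
  "(\<lambda>x. exp (- V (x, y))) \<in> borel_measurable borel"
  "(\<lambda>x. slice_grad x y) \<in> borel_measurable borel"
  "(\<lambda>x. slice_hess x y h) \<in> borel_measurable borel"
  unfolding slice_grad_def slice_hess_def
  by (intro borel_measurable_continuous_onI continuous_intros)+

lemma slice_derivatives:
  shows "((\<lambda>y. exp (- V (x, y))) has_derivative (\<lambda>h. slice_grad x y \<bullet> h)) (at y)"
    and "(slice_grad x has_derivative slice_hess x y) (at y)"
proof -
  have l: "((\<lambda>y. (x, y)) has_derivative (\<lambda>h. (0, h))) (at y)"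
    by (auto intro!: derivative_eq_intros)
  have dV: "((\<lambda>y. V (x, y)) has_derivative (\<lambda>h. snd (G (x, y)) \<bullet> h)) (at y)"
    using has_derivative_compose[OF l twice_diffD(1)[OF td]] by (simp add: inner_prod_def)
  have dG: "((\<lambda>y. G (x, y)) has_derivative (\<lambda>h. H (x, y) (0, h))) (at y)"
    using has_derivative_compose[OF l twice_diffD(2)[OF td]] .
  show 1: "((\<lambda>y. exp (- V (x, y))) has_derivative (\<lambda>h. slice_grad x y \<bullet> h)) (at y)"
    by (rule has_derivative_eq_rhs[OF has_derivative_exp[OF has_derivative_minus[OF dV]]])
       (simp add: slice_grad_def fun_eq_iff)
  have 2: "((\<lambda>y. snd (G (x, y))) has_derivative (\<lambda>h. snd (H (x, y) (0, h)))) (at y)"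
    by (rule has_derivative_snd[OF dG])
  show "(slice_grad x has_derivative slice_hess x y) (at y)"
    unfolding slice_grad_def[abs_def]
    by (rule has_derivative_eq_rhs[OF has_derivative_minus[OF has_derivative_scaleR[OF 1 2]]])
       (auto simp: slice_grad_def slice_hess_def algebra_simps intro!: ext)
qed

lemma slice_bounds:
  "exp (- V (x, y)) \<le> envelope x" "norm (slice_grad x y) \<le> envelope x" "norm (slice_hess x y h) \<le> envelope x * norm h"
proof -
  let ?e = "exp (- V (x, y))" and ?n = "norm (G (x, y))"
  have sn: "norm (snd (G (x, y))) \<le> ?n"
    using norm_snd_le[of "snd (G (x, y))" "fst (G (x, y))"] by simp
  have sq: "?n \<le> 1 + ?n\<^sup>2" 
    using zero_le_power2[of "?n - 1/2"] by (simp add: power2_eq_square algebra_simps)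
  note wb = weight_bound[of x y]
  have le: "c * ?e \<le> envelope x" if "c \<le> 1 + L + ?n\<^sup>2" for c
    using mult_right_mono[OF that, of ?e] wb by (meson exp_ge_zero order_trans)
  show "?e \<le> envelope x" using le[of 1] L by simp
  have "norm (slice_grad x y) \<le> ?n * ?e" using sn by (simp add: slice_grad_def mult.commute mult_right_mono)
  then show "norm (slice_grad x y) \<le> envelope x" using le[of ?n] sq L by simp
  have "norm (H (x, y) (0, h)) \<le> L * norm (0::'x, h)" by (rule hessian_norm_le[OF td up L cv])
  then have hb: "norm (snd (H (x, y) (0, h))) \<le> L * norm h"
    using norm_snd_le[of "snd (H (x, y) (0, h))" "fst (H (x, y) (0, h))"] by (simp add: norm_Pair)
  have "norm ((snd (G (x, y)) \<bullet> h) *\<^sub>R snd (G (x, y)) - snd (H (x, y) (0, h)))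
      \<le> (norm (snd (G (x, y))) * norm h) * norm (snd (G (x, y))) + L * norm h"
    using hb Cauchy_Schwarz_ineq2[of "snd (G (x, y))" h]
    by (intro order_trans[OF norm_triangle_ineq4 add_mono]) (auto intro: mult_right_mono)
  also have "\<dots> \<le> (?n * norm h) * ?n + L * norm h"
    using sn L by (intro add_mono mult_mono) auto
  also have "\<dots> = (L + ?n\<^sup>2) * norm h" by (simp add: power2_eq_square algebra_simps)
  finally have "norm (slice_hess x y h) \<le> ?e * ((L + ?n\<^sup>2) * norm h)" by (simp add: slice_hess_def)
  also have "\<dots> \<le> envelope x * norm h" using le[of "L + ?n\<^sup>2"] by (simp add: mult.assoc[symmetric] mult.commute[of ?e] mult_right_mono)
  finally show "norm (slice_hess x y h) \<le> envelope x * norm h" .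
qed

lemma slices_integrable:
  "integrable lborel (\<lambda>x. exp (- V (x, y)))" "integrable lborel (\<lambda>x. slice_grad x y)"
  "integrable lborel (\<lambda>x. slice_hess x y h)"
proof -
  show "integrable lborel (\<lambda>x. exp (- V (x, y)))" "integrable lborel (\<lambda>x. slice_grad x y)"
    using slice_bounds envelope_nonneg
    by (auto intro!: Bochner_Integration.integrable_bound[OF envelope_integrable] AE_I2)
  show "integrable lborel (\<lambda>x. slice_hess x y h)"
    using slice_bounds envelope_nonneg
    by (auto intro!: Bochner_Integration.integrable_bound[OF integrable_mult_left[OF envelope_integrable, of "norm h"]] AE_I2)
qed

lemma P_pos: "0 < P y"
proof -
  have "P y \<noteq> 0"
  proof
    assume "P y = 0"
    then have "AE x in lborel. exp (- V (x, y)) = 0"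
      unfolding P_def by (subst (asm) integral_nonneg_eq_0_iff_AE) (auto simp: slices_integrable)
    then have "AE x in (lborel :: 'x measure). False" by simp
    then show False by (simp add: eventually_False ae_filter_eq_bot_iff)
  qed
  moreover have "0 \<le> P y" by (simp add: P_def)
  ultimately show ?thesis by simp
qed

definition grad_P :: "'y \<Rightarrow> 'y" where "grad_P y = (\<integral>x. slice_grad x y \<partial>lborel)"
definition hess_P :: "'y \<Rightarrow> 'y \<Rightarrow> 'y" where "hess_P y h = (\<integral>x. slice_hess x y h \<partial>lborel)"

lemma P_derivatives:
  shows "(P has_derivative (\<lambda>h. grad_P y \<bullet> h)) (at y)" and "(grad_P has_derivative hess_P y) (at y)"
proof -
  have "norm (slice_grad x y \<bullet> h) \<le> envelope x * norm h" for x y h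
    using order_trans[OF Cauchy_Schwarz_ineq2[of "slice_grad x y" h] mult_right_mono[OF slice_bounds(2)]] by simp
  then have "((\<lambda>y. \<integral>x. exp (- V (x, y)) \<partial>lborel) has_derivative (\<lambda>h. \<integral>x. slice_grad x y \<bullet> h \<partial>lborel)) (at y)"
    by (intro has_derivative_integral[where g=envelope])
       (auto simp: slice_derivatives envelope_integrable envelope_nonneg slices_integrable)
  then show "(P has_derivative (\<lambda>h. grad_P y \<bullet> h)) (at y)"
    unfolding P_def[abs_def] grad_P_def by (simp add: slices_integrable)
  show "(grad_P has_derivative hess_P y) (at y)"
    unfolding grad_P_def[abs_def] hess_P_def[abs_def]
    by (intro has_derivative_integral[where g=envelope])
       (auto simp: slice_derivatives envelope_integrable envelope_nonneg slices_integrable slice_bounds)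
qed

lemma continuous_hess_P: "continuous_on UNIV (\<lambda>y. hess_P y h)"
  unfolding hess_P_def
proof (rule continuous_on_integral_dominated)
  show "continuous_on UNIV (\<lambda>y. slice_hess x y h)" for x
    unfolding slice_hess_def by (intro continuous_intros)
qed (use slice_bounds in \<open>auto intro: integrable_mult_left[OF envelope_integrable, of "norm h"]\<close>)

definition V_marg :: "'y \<Rightarrow> real" where "V_marg y = - ln (P y)"
definition G_marg :: "'y \<Rightarrow> 'y" where "G_marg y = - (inverse (P y) *\<^sub>R grad_P y)"
text \<open>
  The derivative of \<open>G_marg\<close>, by the quotient rule.
\<close>

definition H_marg :: "'y \<Rightarrow> 'y \<Rightarrow> 'y" where
  "H_marg y h = inverse (P y) *\<^sub>R (((grad_P y \<bullet> h) / P y) *\<^sub>R grad_P y - hess_P y h)"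

lemma twice_diff_marg: "twice_diff V_marg G_marg H_marg"
  unfolding twice_diff_def
proof safe
  fix y
  have P0: "P y \<noteq> 0" using P_pos[of y] by simp
  show "(V_marg has_derivative (\<lambda>h. G_marg y \<bullet> h)) (at y)"
    unfolding V_marg_def[abs_def] 
    by (rule has_derivative_eq_rhs[OF has_derivative_minus[OF has_derivative_ln[OF P_pos P_derivatives(1)]]])
       (auto simp: G_marg_def divide_inverse intro!: ext)
  show "(G_marg has_derivative H_marg y) (at y)"
    unfolding G_marg_def[abs_def]
    by (rule has_derivative_eq_rhs[OF has_derivative_minus[OF has_derivative_scaleR[OF
          Deriv.has_derivative_inverse[OF P0 P_derivatives(1)] P_derivatives(2)]]])
       (auto simp: H_marg_def algebra_simps divide_inverse intro!: ext)
qed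

lemma continuous_H_marg: "continuous_on UNIV (\<lambda>y. H_marg y h)"
proof -
  have "continuous_on UNIV P" "continuous_on UNIV grad_P"
    using P_derivatives by (meson has_derivative_continuous continuous_at_imp_continuous_on)+
  then show ?thesis
    unfolding H_marg_def using P_pos by (intro continuous_intros continuous_hess_P) (auto simp: less_le)
qed

section \<open>Hessian bounds pass to the marginal potential\<close>

lemma nn_integral_slice: "(\<integral>\<^sup>+x. ennreal (exp (- V (x, y))) \<partial>lborel) = ennreal (P y)"
  unfolding P_def by (rule nn_integral_eq_integral[OF slices_integrable(1)]) simp

text \<open>
  Apply Prekopa--Leindler in \<open>x\<close> to the slices at \<open>y + h\<close>, \<open>y - h\<close> and \<open>y\<close>. The points
  \<open>(x, y + h)\<close> and \<open>(x', y - h)\<close> are \<open>z + (k, h)\<close> and \<open>z - (k, h)\<close> for \<open>z\<close> their midpoint, so the second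
  difference bound for \<open>V\<close> is exactly the required pointwise hypothesis once \<open>m |k|\<^sup>2 \<ge> 0\<close> is
  discarded, which is where \<open>0 \<le> m\<close> enters.
\<close>

lemma marg_second_difference_lower:
  assumes low: "\<forall>z v. m * (v \<bullet> v) \<le> H z v \<bullet> v" and m: "0 \<le> m"
  shows "2 * V_marg y + m * (h \<bullet> h) \<le> V_marg (y + h) + V_marg (y - h)"
proof -
  define c where "c = exp (- (m * (h \<bullet> h) / 2))"
  have "(\<integral>\<^sup>+x. ennreal (exp (- V (x, y + h))) \<partial>lborel) * (\<integral>\<^sup>+x. ennreal (exp (- V (x, y - h))) \<partial>lborel)
      \<le> (\<integral>\<^sup>+x. ennreal c * ennreal (exp (- V (x, y))) \<partial>lborel)\<^sup>2"
  proof (rule prekopa_leindler)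
    fix x x' :: 'x
    define w k where "w = (1 / 2) *\<^sub>R (x + x')" and "k = (1 / 2) *\<^sub>R (x - x')"
    have "w + k = (1/2 + 1/2) *\<^sub>R x" "w - k = (1/2 + 1/2) *\<^sub>R x'"
      unfolding scaleR_add_left by (simp_all add: w_def k_def algebra_simps)
    then have wk: "w + k = x" "w - k = x'" by simp_all
    have "2 * V (w, y) + m * ((k, h) \<bullet> (k, h)) \<le> V ((w, y) + (k, h)) + V ((w, y) - (k, h))"
      using low hessian_lower_bound_iff_second_difference[OF td] by blast
    moreover have "m * (h \<bullet> h) \<le> m * ((k, h) \<bullet> (k, h))"
      using m by (intro mult_left_mono) (simp_all add: inner_prod_def)
    ultimately have "- V (x, y + h) - V (x', y - h) \<le> - (m * (h \<bullet> h)) - 2 * V (w, y)"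
      by (simp add: wk)
    then have "exp (- V (x, y + h) - V (x', y - h)) \<le> exp (- (m * (h \<bullet> h)) - 2 * V (w, y))" by simp
    also have "\<dots> = (c * exp (- V (w, y)))\<^sup>2"
      by (simp add: c_def power2_eq_square exp_add[symmetric])
    finally have "exp (- V (x, y + h)) * exp (- V (x', y - h)) \<le> (c * exp (- V (w, y)))\<^sup>2"
      by (simp add: exp_add[symmetric])
    then show "ennreal (exp (- V (x, y + h))) * ennreal (exp (- V (x', y - h)))
        \<le> (ennreal c * ennreal (exp (- V ((1 / 2) *\<^sub>R (x + x'), y))))\<^sup>2"
      unfolding w_def[symmetric]
      by (simp add: ennreal_mult[symmetric] ennreal_power c_def ennreal_leI)
  qed measurable
  moreover have "(\<integral>\<^sup>+x. ennreal c * ennreal (exp (- V (x, y))) \<partial>lborel) = ennreal (c * P y)"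
    by (subst nn_integral_cmult) (auto simp: nn_integral_slice ennreal_mult P_pos less_imp_le c_def)
  ultimately have "ennreal (P (y + h) * P (y - h)) \<le> ennreal ((c * P y)\<^sup>2)"
    using P_pos[THEN less_imp_le] by (simp add: nn_integral_slice ennreal_mult[symmetric] ennreal_power c_def)
  then have "P (y + h) * P (y - h) \<le> (c * P y)\<^sup>2" by (simp add: ennreal_le_iff)
  then have "ln (P (y + h) * P (y - h)) \<le> ln ((c * P y)\<^sup>2)"
    using P_pos by (subst ln_le_cancel_iff) (auto simp: c_def P_pos less_imp_neq[symmetric])
  also have "\<dots> = 2 * (ln c + ln (P y))"
    using P_pos[of y] by (simp add: ln_realpow ln_mult c_def)
  also have "ln (P (y + h) * P (y - h)) = ln (P (y + h)) + ln (P (y - h))"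
    using P_pos by (simp add: ln_mult less_imp_neq[symmetric])
  finally show ?thesis by (simp add: V_marg_def c_def)
qed

text \<open>
  For fixed \<open>x\<close> the slices satisfy
  \<open>exp (- V (x, y)) \<le> c * sqrt (exp (- V (x, y + h)) * exp (- V (x, y - h)))\<close>. Integrating the square
  root is the Cauchy--Schwarz inequality, obtained here from the weighted arithmetic-geometric mean
  inequality \<open>sqrt (p q) \<le> (s p + q / s) / 2\<close> with the one \<open>s\<close> that is optimal after integration.
\<close>

lemma marg_second_difference_upper:
  assumes upM: "\<forall>z v. H z v \<bullet> v \<le> M * (v \<bullet> v)"
  shows "V_marg (y + h) + V_marg (y - h) \<le> 2 * V_marg y + M * (h \<bullet> h)"
proof -
  define c where "c = exp (M * (h \<bullet> h) / 2)"
  define s where "s = sqrt (P (y - h) / P (y + h))"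
  have p: "0 < P (y + h)" "0 < P (y - h)" "0 < P y" by (rule P_pos)+
  have s: "0 < s" using p by (simp add: s_def)
  have sp: "s * P (y + h) = sqrt (P (y + h) * P (y - h))" "P (y - h) / s = sqrt (P (y + h) * P (y - h))"
    using p by (simp_all add: s_def real_sqrt_divide real_sqrt_mult field_simps)
  have sq: "(exp (- u / 2))\<^sup>2 = exp (- u)" for u :: real
    by (simp add: power2_eq_square exp_add[symmetric])
  have pt: "exp (- V (x, y)) \<le> c / 2 * (s * exp (- V (x, y + h)) + exp (- V (x, y - h)) / s)" for x
  proof -
    have "V ((x, y) + (0, h)) + V ((x, y) - (0, h)) \<le> 2 * V (x, y) + M * ((0, h) \<bullet> (0::'x, h))"
      using upM hessian_upper_bound_iff_second_difference[OF td] by blast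
    then have "- V (x, y) \<le> M * (h \<bullet> h) / 2 + (- V (x, y + h) / 2 + - V (x, y - h) / 2)" by simp
    then have "exp (- V (x, y)) \<le> c * (exp (- V (x, y + h) / 2) * exp (- V (x, y - h) / 2))"
      unfolding c_def exp_add[symmetric] by simp
    also have "\<dots> \<le> c * ((s * (exp (- V (x, y + h) / 2))\<^sup>2 + (exp (- V (x, y - h) / 2))\<^sup>2 / s) / 2)"
    proof (rule mult_left_mono)
      have "0 \<le> (s * exp (- V (x, y + h) / 2) - exp (- V (x, y - h) / 2))\<^sup>2" by simp
      then show "exp (- V (x, y + h) / 2) * exp (- V (x, y - h) / 2) \<le>
          (s * (exp (- V (x, y + h) / 2))\<^sup>2 + (exp (- V (x, y - h) / 2))\<^sup>2 / s) / 2"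
        using s by (simp add: power2_eq_square field_simps)
    qed (simp add: c_def)
    finally show ?thesis unfolding sq by simp
  qed
  have "P y \<le> (\<integral>x. c / 2 * (s * exp (- V (x, y + h)) + exp (- V (x, y - h)) / s) \<partial>lborel)"
    unfolding P_def by (intro integral_mono pt) (auto simp: slices_integrable)
  also have "\<dots> = c / 2 * (s * P (y + h) + P (y - h) / s)"
    unfolding P_def by (simp add: slices_integrable)
  also have "\<dots> = c * sqrt (P (y + h) * P (y - h))" by (simp add: sp)
  finally have "ln (P y) \<le> ln (c * sqrt (P (y + h) * P (y - h)))"
    using p by (simp add: c_def)
  also have "\<dots> = M * (h \<bullet> h) / 2 + (ln (P (y + h)) + ln (P (y - h))) / 2"
    using p by (simp add: ln_mult ln_sqrt c_def)
  finally show ?thesis unfolding V_marg_def by (simp add: field_simps)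
qed

lemma marg_hessian_lower:
  assumes "\<forall>z v. m * (v \<bullet> v) \<le> H z v \<bullet> v" and "0 \<le> m"
  shows "\<forall>y v. m * (v \<bullet> v) \<le> H_marg y v \<bullet> v"
  unfolding hessian_lower_bound_iff_second_difference[OF twice_diff_marg]
  using marg_second_difference_lower[OF assms] by blast

lemma marg_hessian_upper:
  assumes "\<forall>z v. H z v \<bullet> v \<le> M * (v \<bullet> v)"
  shows "\<forall>y v. H_marg y v \<bullet> v \<le> M * (v \<bullet> v)"
  unfolding hessian_upper_bound_iff_second_difference[OF twice_diff_marg]
  using marg_second_difference_upper[OF assms] by blast

lemma convex_V_marg: "convex_on UNIV V_marg"
proof (rule convex_of_hessian_nonneg[OF twice_diff_marg])
  have "\<forall>z v. 0 * (v \<bullet> v) \<le> H z v \<bullet> v"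
    unfolding hessian_lower_bound_iff_second_difference[OF td] using midpoint_of_convex[OF cv] by simp
  from marg_hessian_lower[OF this] show "0 \<le> H_marg y v \<bullet> v" for y v by simp
qed

text \<open>
  Tonelli's theorem; it also identifies the total mass of the marginal density.
\<close>

lemma distr_of_marg: "distr_of P = distr (distr_of (\<lambda>z. exp (- V z))) borel snd"
proof (rule measure_eqI)
  fix A assume "A \<in> sets (distr_of P)"
  then have A[measurable]: "A \<in> sets borel" by (simp add: distr_of_def)
  have [measurable]: "P \<in> borel_measurable borel"
    using P_derivatives(1)
    by (intro borel_measurable_continuous_onI)
       (meson has_derivative_continuous continuous_at_imp_continuous_on)
  have V[measurable]: "V \<in> borel_measurable borel"
    by (rule borel_measurable_continuous_onI[OF continuous_V])
  have [measurable]: "(snd :: 'x \<times> 'y \<Rightarrow> 'y) \<in> borel_measurable borel"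
    by (intro borel_measurable_continuous_onI continuous_intros)
  then have [measurable]: "(snd -` A :: ('x \<times> 'y) set) \<in> sets borel"
    by (rule measurable_sets_borel[OF _ A])
  have V': "(\<lambda>z. ennreal (exp (- V z)) * indicator (snd -` A) z) \<in> borel_measurable (lborel \<Otimes>\<^sub>M lborel)"
    unfolding lborel_prod by measurable
  have "emeasure (distr (distr_of (\<lambda>z. exp (- V z))) borel snd) A =
      (\<integral>\<^sup>+z. ennreal (exp (- V z)) * indicator (snd -` A) z \<partial>lborel)"
    by (subst emeasure_distr) (auto simp: distr_of_def emeasure_density)
  also have "\<dots> = (\<integral>\<^sup>+z. ennreal (exp (- V z)) * indicator (snd -` A) z \<partial>(lborel \<Otimes>\<^sub>M lborel))"
    by (simp add: lborel_prod)
  also have "\<dots> = (\<integral>\<^sup>+y. (\<integral>\<^sup>+x. ennreal (exp (- V (x, y))) * indicator (snd -` A) (x, y) \<partial>lborel) \<partial>lborel)"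
    by (rule lborel_pair.nn_integral_snd[OF V', symmetric])
  also have "\<dots> = (\<integral>\<^sup>+y. ennreal (P y) * indicator A y \<partial>lborel)"
    by (simp add: nn_integral_slice[symmetric] nn_integral_multc[symmetric] indicator_def of_bool_def
        cong: nn_integral_cong)
  also have "\<dots> = emeasure (distr_of P) A" by (simp add: distr_of_def emeasure_density)
  finally show "emeasure (distr_of P) A = emeasure (distr (distr_of (\<lambda>z. exp (- V z))) borel snd) A" ..
qed (simp add: distr_of_def)
end

section \<open>Isoperimetry under contractions\<close>

text \<open>
  Preimages under \<open>T\<close> keep the masses and do not bring \<open>S1\<close> and \<open>S2\<close> closer together. Surjectivity
  keeps the preimages of nonempty sets nonempty.
\<close>

lemma isoperimetric_contraction:
  fixes T :: "'a::euclidean_space \<Rightarrow> 'b::euclidean_space"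
  assumes iso: "isoperimetric \<mu> c" and sets: "sets \<mu> = sets borel"
    and T: "T \<in> borel_measurable borel" "surj T" "\<And>x y. dist (T x) (T y) \<le> dist x y"
  shows "isoperimetric (distr \<mu> borel T) c"
  unfolding isoperimetric_def
proof (intro conjI ballI impI)
  show c: "0 < c" using iso by (simp add: isoperimetric_def)
  fix S1 S2 S3 :: "'b set"
  assume S: "S1 \<in> sets borel" "S2 \<in> sets borel" "S3 \<in> sets borel"
  assume part: "S1 \<union> S2 \<union> S3 = UNIV \<and> S1 \<inter> S2 = {} \<and> S1 \<inter> S3 = {} \<and> S2 \<inter> S3 = {} \<and> S1 \<noteq> {} \<and> S2 \<noteq> {}"
  have Tm: "T -` S \<in> sets borel" if "S \<in> sets borel" for S
    using measurable_sets_borel[OF T(1) that] .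
  have T\<mu>: "T \<in> measurable \<mu> borel" using T(1) sets by (simp cong: measurable_cong_sets)
  have sp: "space \<mu> = UNIV" using sets_eq_imp_space_eq[OF sets] by simp
  have meas: "measure (distr \<mu> borel T) S = measure \<mu> (T -` S)" if "S \<in> sets borel" for S
    using measure_distr[OF T\<mu> that] sp by simp
  have ne: "T -` S1 \<noteq> {}" "T -` S2 \<noteq> {}" using part T(2) by (simp_all add: surj_vimage_empty)
  have d: "setdist S1 S2 \<le> setdist (T -` S1) (T -` S2)"
  proof (rule le_setdistI[OF ne])
    fix x y assume "x \<in> T -` S1" "y \<in> T -` S2"
    then have "setdist S1 S2 \<le> dist (T x) (T y)" by (intro setdist_le_dist) auto
    then show "setdist S1 S2 \<le> dist x y" using T(3)[of x y] by linarith
  qed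
  have "c * setdist S1 S2 * measure \<mu> (T -` S1) * measure \<mu> (T -` S2)
      \<le> c * setdist (T -` S1) (T -` S2) * measure \<mu> (T -` S1) * measure \<mu> (T -` S2)"
    using d c by (intro mult_right_mono mult_left_mono) auto
  also have "\<dots> \<le> measure \<mu> (T -` S3)"
  proof -
    have "T -` S1 \<union> T -` S2 \<union> T -` S3 = UNIV" "T -` S1 \<inter> T -` S2 = {}" "T -` S1 \<inter> T -` S3 = {}"
      "T -` S2 \<inter> T -` S3 = {}"
      using part by blast+
    then show ?thesis using iso ne Tm[OF S(1)] Tm[OF S(2)] Tm[OF S(3)]
      unfolding isoperimetric_def by blast
  qed
  finally show "c * setdist S1 S2 * measure (distr \<mu> borel T) S1 * measure (distr \<mu> borel T) S2
      \<le> measure (distr \<mu> borel T) S3"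
    by (simp add: meas S)
qed

lemma psi_contraction:
  assumes "sets \<mu> = sets borel" "T \<in> borel_measurable borel" "surj T"
    "\<And>x y. dist (T x) (T y) \<le> dist x y"
  shows "psi \<mu> \<le> psi (distr \<mu> borel T)"
  unfolding psi_def using isoperimetric_contraction[OF _ assms] by (intro Sup_subset_mono) blast

section \<open>Condition numbers of marginals\<close>

lemma ennreal_divide_mono:
  fixes a b c d :: ennreal
  assumes "a \<le> b" "d \<le> c"
  shows "a / c \<le> b / d"
proof -
  have "inverse c \<le> inverse d"
  proof (cases "d = 0 \<or> c = top")
    case True
    then show ?thesis by auto
  next
    case False
    then obtain r s where rs: "d = ennreal r" "c = ennreal s" "0 < r" "0 \<le> s"
      using assms(2) by (cases d; cases c) (auto simp: top_unique)
    then have "r \<le> s" using assms(2) by simp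
    then show ?thesis using rs by (simp add: inverse_ennreal le_imp_inverse_le ennreal_leI)
  qed
  then show ?thesis using assms(1) unfolding divide_ennreal_def by (intro mult_mono) auto
qed

theorem corollary4p8:
  fixes V_joint :: "(real ^ 'nx) \<times> (real ^ 'ny) \<Rightarrow> real"
    and \<pi>_joint :: "(real ^ 'nx) \<times> (real ^ 'ny) \<Rightarrow> real"
    and \<pi>_marg :: "real ^ 'ny \<Rightarrow> real"
  assumes joint: "\<pi>_joint = (\<lambda>z. exp (- V_joint z))"
    and prob: "prob_space (distr_of \<pi>_joint)"
    and C2: "C2 V_joint"
    and convex: "convex_on UNIV V_joint"
    and L_finite: "L_const \<pi>_joint < \<infinity>"
    and psi_pos: "psi (distr_of \<pi>_joint) > 0"
    and marg: "\<pi>_marg = (\<lambda>y. \<integral>x. \<pi>_joint (x, y) \<partial>lborel)"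
  shows "C2_log_concave_density \<pi>_marg \<and>
         (psi (distr_of \<pi>_marg) > 0 \<and> kappa_hat \<pi>_marg \<le> kappa_hat \<pi>_joint) \<and>
         (m_const \<pi>_joint > 0 \<longrightarrow>
            m_const \<pi>_marg > 0 \<and> kappa \<pi>_marg \<le> kappa \<pi>_joint)"
proof -
  let ?G = "gradient V_joint" and ?H = "hessian V_joint"
  have td: "twice_diff V_joint ?G ?H" by (rule C2_imp_twice_diff[OF C2])
  have pot: "potential \<pi>_joint = V_joint" by (simp add: joint potential_def fun_eq_iff)
  have "{ennreal L | L. 0 \<le> L \<and> (\<forall>z. ?H z \<preceq>\<^sub>L (\<lambda>v. L *\<^sub>R v))} \<noteq> {}"
    using L_finite unfolding L_const_def pot by (metis Inf_empty infinity_ennreal_def less_irrefl top_ennreal_def)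
  then obtain L where L: "0 \<le> L" "\<And>z v. ?H z v \<bullet> v \<le> L * (v \<bullet> v)"
    by (auto simp: loewner_le_def)
  have cont: "continuous_on UNIV V_joint"
    using twice_diffD(1)[OF td] by (meson has_derivative_continuous continuous_at_imp_continuous_on)
  have Vm: "V_joint \<in> borel_measurable borel" by (rule borel_measurable_continuous_onI[OF cont])
  have "(\<integral>\<^sup>+z. ennreal (exp (- V_joint z)) \<partial>lborel) = 1"
    using prob_space.emeasure_space_1[OF prob] Vm by (simp add: distr_of_def joint emeasure_density)
  then obtain a b where ab: "0 < a" "\<And>z. a * norm z - b \<le> V_joint z"
    using convex_integrable_growth[OF convex cont] by auto
  \<comment> \<open>\<open>L\<close> itself may be \<open>0\<close> here; a positive bound is needed for gradient steps of length \<open>1 / L\<close>. The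
  sharp constants are compared afterwards, for every admissible \<open>M\<close> and \<open>m\<close> separately.\<close>
  interpret smooth_log_concave_joint V_joint ?G ?H "L + 1" a b
  proof
    show "?H z v \<bullet> v \<le> (L + 1) * (v \<bullet> v)" for z v
      using L(2)[of z v] by (simp add: distrib_right add_increasing2)
    show "continuous_on UNIV (\<lambda>z. ?H z h)" for h using C2 unfolding C2_def by blast
  qed (use td convex L ab in auto)
  have margP: "\<pi>_marg = P" by (simp add: marg joint P_def fun_eq_iff)
  have expP: "P = (\<lambda>y. exp (- V_marg y))" using P_pos by (simp add: V_marg_def fun_eq_iff)
  have potm: "potential \<pi>_marg = V_marg" by (simp add: margP potential_def V_marg_def fun_eq_iff)
  note hm = twice_diff_gradient_hessian(2)[OF twice_diff_marg]
  have dm: "distr_of \<pi>_marg = distr (distr_of \<pi>_joint) borel snd"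
    unfolding margP joint by (rule distr_of_marg)
  have snd_meas: "(snd :: (real ^ 'nx) \<times> (real ^ 'ny) \<Rightarrow> _) \<in> borel_measurable borel"
    by (intro borel_measurable_continuous_onI continuous_intros)
  have "prob_space (distr_of \<pi>_marg)"
    unfolding dm using snd_meas by (intro prob_space.prob_space_distr[OF prob]) (simp add: distr_of_def)
  then have density: "C2_log_concave_density \<pi>_marg"
    unfolding C2_log_concave_density_def
    using expP margP convex_V_marg twice_diff_imp_C2[OF twice_diff_marg continuous_H_marg] by metis
  have L_le: "L_const \<pi>_marg \<le> L_const \<pi>_joint"
    unfolding L_const_def pot potm hm loewner_le_def
    using marg_hessian_upper by (intro Inf_superset_mono) (auto simp: inner_scaleR_left)
  have m_le: "m_const \<pi>_joint \<le> m_const \<pi>_marg"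
    unfolding m_const_def pot potm hm loewner_le_def
    using marg_hessian_lower by (intro Sup_subset_mono) (auto simp: inner_scaleR_left)
  have psi_le: "psi (distr_of \<pi>_joint) \<le> psi (distr_of \<pi>_marg)"
    unfolding dm using snd_meas
    by (intro psi_contraction) (auto simp: distr_of_def surj_def dist_snd_le)
  have "kappa_hat \<pi>_marg \<le> kappa_hat \<pi>_joint"
    unfolding kappa_hat_def using L_le psi_le by (intro ennreal_divide_mono power_mono) auto
  moreover have "kappa \<pi>_marg \<le> kappa \<pi>_joint"
    unfolding kappa_def using L_le m_le by (intro ennreal_divide_mono) auto
  ultimately show ?thesis using density psi_le psi_pos m_le by (auto intro: less_le_trans)
qed

end
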